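(* Let $(\beta_n)$ be a sequence of Pisot numbers in $(1,2)$ and suppose that $$W_1(\mu_{I_{\beta_n}},\mathcal L_{I_{\beta_n}})\to 0,$$ where $W_1$ denotes the Wasserstein metric on the space of probability measures on the Euclidean line. Then $\dim_H(\nu_{\beta_n})\to 1$.
   Context: A Pisot number is a real algebraic integer $\beta>1$ all of whose other Galois conjugates have modulus strictly less than one. For $\beta\in(1,2)$ the Bernoulli convolution $\nu_\beta$ is the weak$^*$ limit as $n\to\infty$ of the probability measures $\sum_{a_1\cdots a_n\in\{0,1\}^n}\frac1{2^n}\delta_{\sum_{i=1}^n a_i\beta^{-i}}$; $\dim_H(\nu_\beta)$ is its Hausdorff dimension. $X(\beta):=\left\{\sum_{i=1}^n c_i\beta^{n-i}: n\in\mathbb N,\ c_i\in\{-1,0,1\}\right\}$. For $x\in\mathbb R$, $n\in\mathbb N$, $\mathcal N_n(x)=\#\{(a_1,\dots,a_n,b_1,\dots,b_n)\in\{0,1\}^{2n}: \sum_{i=1}^n (a_i-b_i)\beta^{n-i}=x\}$. For Pisot $\beta\in(1,2)$ there is a unique real number $\lambda=\lambda(\beta)>1$ such that for every $x\in X(\beta)$ the limit $\mu(x):=\lim_{n\to\infty}\lambda^{-n}\mathcal N_n(x)$ exists and lies in $(0,\infty)$; $\mu$ is regarded as a measure supported on $X(\beta)$ with mass $\mu(x)$ at $x$. $I_\beta:=[\frac{-1}{\beta-1},\frac{1}{\beta-1}]$ (the set $X(\beta)\cap I_\beta$ is finite for Pisot $\beta$), $\mu_{I_\beta}:=\frac{1}{\mu(I_\beta)}\mu|_{I_\beta}$,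 and $\mathcal L_{I_\beta}$ is normalised (probability) Lebesgue measure on $I_\beta$. *)

theory Defs
  imports
    "HOL-Probability.Probability"
    "HOL-Computational_Algebra.Computational_Algebra"
begin

text \<open>The Galois conjugates of an algebraic real number are the complex roots of its minimal
  polynomial over the rationals, which up to a constant factor is the only irreducible rational
  polynomial that vanishes there.\<close>

definition galois_conjugates :: "real \<Rightarrow> complex set" where
  "galois_conjugates \<beta> =
     {z. \<exists>p :: rat poly. irreducible p \<and> poly (map_poly of_rat p) \<beta> = 0 \<and>
                         poly (map_poly of_rat p) z = 0}"

definition pisot :: "real \<Rightarrow> bool" where
  "pisot \<beta> \<longleftrightarrow> \<beta> > 1 \<and> algebraic_int \<beta> \<and>
     (\<forall>z \<in> galois_conjugates \<beta> - {complex_of_real \<beta>}. cmod z < 1)"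

text \<open>The case distinction implements the usual convention \<open>0\<^sup>0 = 1\<close> for nonempty sets, so that
  the zero-dimensional Hausdorff measure is counting measure (in HOL, \<open>0 powr 0 = 0\<close>).\<close>

definition hausdorff_weight :: "real \<Rightarrow> 'a::metric_space set \<Rightarrow> ennreal" where
  "hausdorff_weight s U =
     (if U = {} then 0 else if s = 0 then 1 else ennreal (diameter U powr s))"

text \<open>Covering sets are required to be bounded because \<^const>\<open>diameter\<close> is meaningless for
  unbounded sets.\<close>

definition hausdorff_content :: "real \<Rightarrow> real \<Rightarrow> 'a::metric_space set \<Rightarrow> ennreal" where
  "hausdorff_content s \<delta> A =
     (INF U \<in> {U :: nat \<Rightarrow> 'a set. (\<forall>i. bounded (U i) \<and> diameter (U i) \<le> \<delta>) \<and> A \<subseteq> (\<Union>i. U i)}.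
        \<Sum>i. hausdorff_weight s (U i))"

definition hausdorff_measure :: "real \<Rightarrow> 'a::metric_space set \<Rightarrow> ennreal" where
  "hausdorff_measure s A = (SUP \<delta> \<in> {0<..}. hausdorff_content s \<delta> A)"

definition hausdorff_dim :: "'a::metric_space set \<Rightarrow> ennreal" where
  "hausdorff_dim A = Inf {ennreal s | s. s \<ge> 0 \<and> hausdorff_measure s A = 0}"

text \<open>Of the usual definitions this is the one through Borel sets of full measure; for exact
  dimensional measures, such as Bernoulli convolutions, it agrees with the one through sets of
  positive measure.\<close>

definition measure_hausdorff_dim :: "'a::metric_space measure \<Rightarrow> ennreal" where
  "measure_hausdorff_dim M = (INF A \<in> {A \<in> sets M. emeasure M A = 1}. hausdorff_dim A)"

definition bernoulli_approx :: "real \<Rightarrow> nat \<Rightarrow> real measure" where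
  "bernoulli_approx \<beta> n =
     distr (uniform_count_measure ({1..n} \<rightarrow>\<^sub>E {0, 1 :: real})) borel
       (\<lambda>a. \<Sum>i=1..n. a i * (1 / \<beta>) ^ i)"

definition bernoulli_convolution :: "real \<Rightarrow> real measure" where
  "bernoulli_convolution \<beta> =
     (THE M. real_distribution M \<and> weak_conv_m (bernoulli_approx \<beta>) M)"

definition beta_spectrum :: "real \<Rightarrow> real set" where
  "beta_spectrum \<beta> =
     {x. \<exists>n. \<exists>c \<in> {1..n} \<rightarrow>\<^sub>E {-1, 0, 1 :: real}. x = (\<Sum>i=1..n. c i * \<beta> ^ (n - i))}"

definition num_reps :: "real \<Rightarrow> nat \<Rightarrow> real \<Rightarrow> nat" where
  "num_reps \<beta> n x =
     card {(a, b). a \<in> {1..n} \<rightarrow>\<^sub>E {0, 1 :: real} \<and> b \<in> {1..n} \<rightarrow>\<^sub>E {0, 1 :: real} \<and>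
                   (\<Sum>i=1..n. (a i - b i) * \<beta> ^ (n - i)) = x}"

text \<open>For Pisot \<open>\<beta>\<close> in \<open>(1,2)\<close> exactly one \<open>l\<close> has this property; for other \<open>\<beta>\<close> the value
  is not meaningful.\<close>

definition growth_rate :: "real \<Rightarrow> real" where
  "growth_rate \<beta> =
     (THE l. l > 1 \<and>
        (\<forall>x \<in> beta_spectrum \<beta>. \<exists>m > 0. (\<lambda>n. real (num_reps \<beta> n x) / l ^ n) \<longlonglongrightarrow> m))"

definition spectrum_mass :: "real \<Rightarrow> real \<Rightarrow> real" where
  "spectrum_mass \<beta> x = lim (\<lambda>n. real (num_reps \<beta> n x) / growth_rate \<beta> ^ n)"

definition spectrum_measure :: "real \<Rightarrow> real measure" where
  "spectrum_measure \<beta> =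
     distr (point_measure (beta_spectrum \<beta>) (\<lambda>x. ennreal (spectrum_mass \<beta> x))) borel (\<lambda>x. x)"

definition I_interval :: "real \<Rightarrow> real set" where
  "I_interval \<beta> = {- 1 / (\<beta> - 1) .. 1 / (\<beta> - 1)}"

text \<open>For any measure, \<^const>\<open>uniform_measure\<close> is its normalised restriction to a set.\<close>

definition spectrum_prob :: "real \<Rightarrow> real measure" where
  "spectrum_prob \<beta> = uniform_measure (spectrum_measure \<beta>) (I_interval \<beta>)"

definition lebesgue_prob :: "real \<Rightarrow> real measure" where
  "lebesgue_prob \<beta> = uniform_measure lborel (I_interval \<beta>)"

definition couplings :: "real measure \<Rightarrow> real measure \<Rightarrow> (real \<times> real) measure set" where
  "couplings M N =
     {P. sets P = sets (borel \<Otimes>\<^sub>M borel) \<and> distr P borel fst = M \<and> distr P borel snd = N}"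

definition wasserstein1 :: "real measure \<Rightarrow> real measure \<Rightarrow> ennreal" where
  "wasserstein1 M N = (INF P \<in> couplings M N. \<integral>\<^sup>+ (x, y). ennreal (dist x y) \<partial>P)"

end

theory Submission
  imports Defs
begin

text \<open>Write \<open>N\<^sub>n(x)\<close> for the number of pairs of words of length \<open>n\<close> whose values differ by \<open>x\<close>, and
  \<open>l\<close> for the growth rate. Two random words of length \<open>n\<close> have equal values with probability
  \<open>N\<^sub>n(0) / 4\<^sup>n\<close>, which is of order \<open>(l / 4)\<^sup>n\<close>; so \<open>ln (4 / l) / ln \<beta>\<close> is the correlation
  dimension of the Bernoulli convolution and a lower bound for its Hausdorff dimension. The dimension
  never exceeds that of the line. It remains to see that \<open>4 / l\<close> is asymptotically at least \<open>\<beta>\<close>.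

  This is where the hypothesis on \<open>\<mu>\<close> enters. Appending one digit to each word shows that \<open>\<mu>\<close> is an
  eigenvector, \<open>l \<mu>(x) = \<mu>((x - 1) / \<beta>) + 2 \<mu>(x / \<beta>) + \<mu>((x + 1) / \<beta>)\<close>. The three maps
  \<open>x \<mapsto> (x - d) / \<beta>\<close> send \<open>I\<close> into itself, so summing over \<open>I\<close> expresses \<open>l\<close> as
  the sum, with weights \<open>1, 2, 1\<close>, of the \<open>\<mu>\<^sub>I\<close>-masses of three subintervals of \<open>I\<close>
  (\<open>growth_rate_eq_branches\<close>). Normalised Lebesgue measure gives each of them mass \<open>1 / \<beta>\<close>, hence the
  total \<open>4 / \<beta>\<close>, and a small Wasserstein distance forces \<open>l\<close> to be at most slightly larger
  (\<open>growth_rate_le_of_wasserstein\<close>).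

  Three facts about Pisot numbers and Bernoulli convolutions carry the argument.

  \<^item> The growth rate exists (\<open>growth_rate_props\<close>). Reduction modulo the minimal polynomial shows that
    the spectrum is finite in bounded intervals. The graph of the transitions \<open>x \<mapsto> \<beta>x + d\<close> on such a
    finite piece need not be strongly connected, but \<open>N\<^sub>n(x) \<le> N\<^sub>n(0)\<close>, and therefore the loop at
    \<open>0\<close> dominates: a Doeblin argument contracts the oscillation of \<open>N\<^sub>n\<^sub>+\<^sub>1 / N\<^sub>n\<close> geometrically.

  \<^item> Pisot numbers stay away from \<open>1\<close> (\<open>pisot_gap\<close>), so \<open>ln \<beta>\<close> in the denominator is harmless. With
    \<open>P\<close> the minimal polynomial and \<open>P\<^sup>*\<close> its reciprocal, \<open>P / P\<^sup>*\<close> has integer coefficients \<open>a\<^sub>n\<close>, and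
    \<open>(1 - \<beta>z) P / P\<^sup>*\<close> is \<open>z - \<beta>\<close> times a Blaschke product. This bounds
    \<open>a\<^sub>0\<^sup>2 + \<Sum> (a\<^sub>n\<^sub>+\<^sub>1 - \<beta> a\<^sub>n)\<^sup>2\<close> by \<open>1 + \<beta>\<^sup>2\<close>, which integers cannot satisfy for \<open>\<beta>\<close> close to \<open>1\<close>.

  \<^item> The correlation dimension bounds the Hausdorff dimension from below
    (\<open>measure_hausdorff_dim_ge\<close>). By Borel--Cantelli almost every digit sequence has only finitely many
    prefixes with too many near neighbours; the remaining sequences give every set of diameter \<open>r\<close> a
    mass of order at most \<open>r\<^sup>s\<close>.\<close>

section \<open>Minimal polynomials of Pisot numbers\<close>

lemma map_poly_of_int_mult:
  "map_poly (of_int :: int \<Rightarrow> 'a :: {comm_ring_1,ring_char_0}) (p * q) = map_poly of_int p * map_poly of_int q"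
  by (rule poly_eqI) (simp add: coeff_map_poly coeff_mult)

lemma map_poly_of_rat_mult:
  "map_poly (of_rat :: rat \<Rightarrow> 'a :: field_char_0) (p * q) = map_poly of_rat p * map_poly of_rat q"
  by (rule poly_eqI) (simp add: coeff_map_poly coeff_mult of_rat_sum of_rat_mult)

lemma map_poly_of_rat_add:
  "map_poly (of_rat :: rat \<Rightarrow> 'a :: field_char_0) (p + q) = map_poly of_rat p + map_poly of_rat q"
  by (rule poly_eqI) (simp add: coeff_map_poly of_rat_add)

lemma map_poly_of_rat_of_int:
  "map_poly (of_rat :: rat \<Rightarrow> 'a :: field_char_0) (map_poly of_int p) = map_poly of_int p"
  by (rule poly_eqI) (simp add: coeff_map_poly)

lemma rat_poly_primitive_multiple:
  fixes p :: "rat poly"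
  assumes "p \<noteq> 0"
  obtains P :: "int poly" and c :: rat where "content P = 1" "map_poly of_int P = smult c p"
proof -
  have "\<exists>c P. c \<noteq> 0 \<and> map_poly of_int P = smult (of_int c) p" for p :: "rat poly"
  proof (induction p)
    case (pCons a p)
    then obtain c P where c: "c \<noteq> 0" and P: "map_poly of_int P = smult (of_int c) p" by blast
    obtain k d where d: "d > 0" and a: "a = of_int k / of_int d"
      by (metis quotient_of_div surj_pair quotient_of_denom_pos)
    have "map_poly of_int (pCons (k * c) (smult d P)) = smult (of_int (c * d)) (pCons a p)"
      using d arg_cong[OF P, of "\<lambda>p. coeff p i" for i]
      by (intro poly_eqI) (auto simp: coeff_map_poly coeff_pCons a split: nat.splits)
    thus ?case using c d by (intro exI[of _ "c * d"] exI[of _ "pCons (k * c) (smult d P)"]) auto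
  next
    case 0
    show ?case by (intro exI[of _ 1] exI[of _ 0]) simp
  qed
  then obtain c P where c: "c \<noteq> 0" and P: "map_poly of_int P = smult (of_int c) p" by blast
  have "P \<noteq> 0" using c P assms by auto
  hence cont: "content P \<noteq> 0" by simp
  have "map_poly of_int P = smult (of_int (content P)) (map_poly rat_of_int (primitive_part P))"
    by (subst content_times_primitive_part[symmetric], rule poly_eqI)
       (simp del: content_times_primitive_part add: coeff_map_poly)
  with P have "smult (of_int (content P)) (map_poly rat_of_int (primitive_part P)) = smult (of_int c) p"
    by simp
  hence "map_poly rat_of_int (primitive_part P) = smult (of_int c / of_int (content P)) p"
    using cont by (metis (no_types, lifting) divide_inverse mult.commute of_int_eq_0_iff right_inverse smult_1_left smult_smult)
  thus ?thesis using that[of "primitive_part P"] \<open>P \<noteq> 0\<close> by simp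
qed

text \<open>Gauss's lemma: scaling both factors to primitive integer polynomials multiplies \<open>R\<close> by the product
  of their leading coefficients, and by multiplicativity of the content this product is a unit.\<close>
lemma monic_factor_of_monic_int_poly:
  fixes p q :: "rat poly" and R :: "int poly"
  assumes R: "lead_coeff R = 1" and eq: "map_poly of_int R = p * q"
    and p: "lead_coeff p = 1"
  obtains P where "lead_coeff P = 1" "p = map_poly of_int P"
proof -
  have "map_poly rat_of_int R \<noteq> 0" using R by (auto simp: map_poly_eq_0_iff)
  hence nz: "p \<noteq> 0" "q \<noteq> 0" using eq by auto
  obtain P c where P: "content P = 1" "map_poly of_int P = smult c p"
    by (rule rat_poly_primitive_multiple[OF nz(1)])
  obtain Q d where Q: "content Q = 1" "map_poly of_int Q = smult d q"
    by (rule rat_poly_primitive_multiple[OF nz(2)])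
  have lq: "lead_coeff q = 1"
  proof -
    have "lead_coeff (map_poly rat_of_int R) = 1" using R by (simp add: degree_map_poly coeff_map_poly)
    thus ?thesis using p by (simp add: eq lead_coeff_mult)
  qed
  have "c = lead_coeff (map_poly rat_of_int P)" using p by (simp add: P(2))
  hence c: "c = of_int (lead_coeff P)" by (simp add: degree_map_poly coeff_map_poly)
  have "d = lead_coeff (map_poly rat_of_int Q)" using lq by (simp add: Q(2))
  hence d: "d = of_int (lead_coeff Q)" by (simp add: degree_map_poly coeff_map_poly)
  have "map_poly rat_of_int (smult (lead_coeff P * lead_coeff Q) R) = map_poly of_int (P * Q)"
  proof -
    have "map_poly rat_of_int (smult (lead_coeff P * lead_coeff Q) R) = smult (c * d) (map_poly of_int R)"
      by (rule poly_eqI) (simp add: coeff_map_poly c d)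
    thus ?thesis by (simp add: map_poly_of_int_mult eq P Q mult_ac)
  qed
  hence "smult (lead_coeff P * lead_coeff Q) R = P * Q"
    by (simp only: poly_eq_iff coeff_map_poly of_int_0 of_int_eq_iff simp_thms)
  hence "content (smult (lead_coeff P * lead_coeff Q) R) = 1"
    by (simp add: content_mult P Q)
  moreover have "content R = 1"
    by (metis R content_dvd_coeff is_unit_content_iff)
  ultimately have "\<bar>lead_coeff P * lead_coeff Q\<bar> = 1" by simp
  hence l: "lead_coeff P = 1 \<or> lead_coeff P = - 1"
    by (metis abs_mult abs_zmult_eq_1 abs_eq_iff' abs_one)
  show ?thesis
  proof (rule that[of "smult (lead_coeff P) P"])
    show "lead_coeff (smult (lead_coeff P) P) = 1" using l by auto
    show "p = map_poly of_int (smult (lead_coeff P) P)"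
    proof -
      have "map_poly rat_of_int (smult (lead_coeff P) P) = smult c (map_poly of_int P)"
        by (rule poly_eqI) (simp add: coeff_map_poly c)
      thus ?thesis using l by (auto simp: P c)
    qed
  qed
qed

text \<open>A polynomial of least degree vanishing at \<open>z\<close> divides all others, because remainders vanish at
  \<open>z\<close> too. The field is left open because the lemma serves both the real number \<open>\<beta>\<close> and its complex
  conjugates.\<close>
lemma rational_minimal_polynomial:
  fixes z :: "'a :: field_char_0"
  assumes "q0 \<noteq> 0" "poly (map_poly of_rat q0) z = 0"
  obtains m :: "rat poly" where "lead_coeff m = 1" "poly (map_poly of_rat m) z = 0" "degree m > 0"
    "\<And>q. poly (map_poly of_rat q) z = 0 \<Longrightarrow> m dvd q"
proof -
  define V where "V = {p :: rat poly. p \<noteq> 0 \<and> poly (map_poly of_rat p) z = 0}"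
  have "q0 \<in> V" using assms by (simp add: V_def)
  then obtain p where p: "p \<in> V" "\<And>q. q \<in> V \<Longrightarrow> degree p \<le> degree q"
    using ex_has_least_nat[of "\<lambda>p. p \<in> V" q0 degree] by blast
  define m where "m = smult (inverse (lead_coeff p)) p"
  have [simp]: "p \<noteq> 0" using p by (auto simp: V_def)
  have deg: "degree m = degree p" by (simp add: m_def)
  have lc: "lead_coeff m = 1" by (simp add: m_def)
  have mV: "poly (map_poly of_rat m) z = 0"
  proof -
    have "map_poly of_rat m = smult (of_rat (inverse (lead_coeff p))) (map_poly of_rat p :: 'a poly)"
      by (rule poly_eqI) (simp add: m_def coeff_map_poly of_rat_mult)
    thus ?thesis using p(1) by (simp add: V_def)
  qed
  have deg_pos: "degree m > 0"
  proof (rule ccontr)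
    assume "\<not> degree m > 0"
    hence "m = 1" using lc by (metis degree_eq_zeroE lead_coeff_pCons(2) neq0_conv one_pCons)
    thus False using mV by simp
  qed
  have "m dvd q" if q: "poly (map_poly of_rat q) z = 0" for q
  proof (rule ccontr)
    assume nd: "\<not> m dvd q"
    define r where "r = q mod m"
    have r: "r \<noteq> 0" using nd by (auto simp: r_def dvd_eq_mod_eq_0)
    have "poly (map_poly of_rat (q div m * m + r)) z = 0"
      using q by (simp add: r_def)
    hence "r \<in> V" using mV r by (simp add: V_def map_poly_of_rat_add map_poly_of_rat_mult)
    moreover have "degree r < degree m"
      using degree_mod_less'[of m q] r deg_pos unfolding r_def by fastforce
    ultimately show False using p(2)[of r] deg by auto
  qed
  thus ?thesis using that lc mV deg_pos by blast
qed

text \<open>The roots are simple because a common root of the polynomial and its derivative would have a minimal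
  polynomial that divides both, whereas the positive-degree divisors of an irreducible polynomial have
  its full degree.\<close>
lemma minimal_polynomial_of_algebraic_int:
  fixes \<beta> :: real
  assumes "algebraic_int \<beta>"
  obtains P :: "int poly" where "lead_coeff P = 1" "irreducible (map_poly rat_of_int P)"
    "poly (map_poly of_int P) \<beta> = 0" "rsquarefree (map_poly of_int P :: complex poly)"
proof -
  obtain R :: "int poly" where R: "poly (map_poly of_int R) \<beta> = 0" "lead_coeff R = 1"
    using assms by (auto simp: algebraic_int_altdef_ipoly)
  have R0: "map_poly rat_of_int R \<noteq> 0" and Rb: "poly (map_poly of_rat (map_poly of_int R)) \<beta> = 0"
    using R by (auto simp: map_poly_of_rat_of_int map_poly_eq_0_iff)
  obtain p where p: "lead_coeff p = 1" "poly (map_poly of_rat p) \<beta> = 0" "degree p > 0"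
    and dvd: "\<And>q. poly (map_poly of_rat q) \<beta> = 0 \<Longrightarrow> p dvd q"
    by (rule rational_minimal_polynomial[OF R0 Rb]) blast
  have irr: "irreducible p"
  proof (rule irreducibleI)
    show "p \<noteq> 0" using p by auto
    show "\<not> is_unit p" using p by (auto simp: is_unit_poly_iff)
  next
    fix a b assume ab: "p = a * b"
    have nz: "a \<noteq> 0" "b \<noteq> 0" using ab p by auto
    have "poly (map_poly of_rat a) \<beta> * poly (map_poly of_rat b) \<beta> = 0"
      using p by (simp add: ab map_poly_of_rat_mult)
    hence "p dvd a \<or> p dvd b" using dvd by auto
    hence "degree p \<le> degree a \<or> degree p \<le> degree b" using nz dvd_imp_degree_le by blast
    hence "degree b = 0 \<or> degree a = 0" using ab nz by (auto simp: degree_mult_eq)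
    thus "is_unit a \<or> is_unit b" using nz by (auto simp: is_unit_iff_degree)
  qed
  obtain q where q: "map_poly of_int R = p * q" using dvd[OF Rb] by (auto elim: dvdE)
  obtain P where P: "lead_coeff P = 1" "p = map_poly of_int P"
    by (rule monic_factor_of_monic_int_poly[OF R(2) q p(1)])
  show ?thesis
  proof (rule that[of P])
    show "lead_coeff P = 1" "irreducible (map_poly rat_of_int P)" using P irr by auto
    show "poly (map_poly of_int P) \<beta> = 0" using p by (simp add: P(2) map_poly_of_rat_of_int)
    show "rsquarefree (map_poly of_int P :: complex poly)"
    proof (unfold rsquarefree_roots, intro allI notI)
      fix z :: complex
      assume z: "poly (map_poly of_int P) z = 0 \<and> poly (pderiv (map_poly of_int P)) z = 0"
      have ev: "map_poly of_rat p = (map_poly of_int P :: complex poly)"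
        by (simp add: P(2) map_poly_of_rat_of_int)
      have ev': "map_poly of_rat (pderiv p) = (pderiv (map_poly of_int P) :: complex poly)"
        by (rule poly_eqI) (simp add: P(2) coeff_map_poly coeff_pderiv of_rat_mult of_rat_add)
      have p': "pderiv p \<noteq> 0" using p by (auto simp: pderiv_eq_0_iff)
      obtain m where m: "degree m > 0" "\<And>q. poly (map_poly of_rat q) z = 0 \<Longrightarrow> m dvd q"
        by (rule rational_minimal_polynomial[of "pderiv p" z]) (use p' z ev' in auto)
      have "m dvd p" "m dvd pderiv p" using m z ev ev' by auto
      then obtain k where k: "p = m * k" by (auto elim: dvdE)
      hence "is_unit k" using irr m(1) by (auto dest!: irreducibleD simp: is_unit_poly_iff)
      hence "degree m = degree p" using k p by (auto simp: is_unit_poly_iff degree_mult_eq)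
      moreover have "degree m \<le> degree (pderiv p)"
        using \<open>m dvd pderiv p\<close> p' by (rule dvd_imp_degree_le)
      ultimately show False using p by (simp add: degree_pderiv)
    qed
  qed
qed

text \<open>The form in which the Pisot property enters the finiteness of the spectrum and the gap. The
  constant coefficient is nonzero since otherwise irreducibility would leave only the polynomial \<open>X\<close>.\<close>
lemma pisot_minimal_polynomial:
  assumes "pisot \<beta>"
  obtains P :: "int poly" where "lead_coeff P = 1" "poly (map_poly of_int P) (complex_of_real \<beta>) = 0"
    "coeff P 0 \<noteq> 0" "rsquarefree (map_poly of_int P :: complex poly)"
    "\<And>z::complex. poly (map_poly of_int P) z = 0 \<Longrightarrow> z \<noteq> complex_of_real \<beta> \<Longrightarrow> cmod z < 1"
proof -
  have b: "\<beta> > 1" "algebraic_int \<beta>" 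
    and conj: "\<And>z. z \<in> galois_conjugates \<beta> \<Longrightarrow> z \<noteq> complex_of_real \<beta> \<Longrightarrow> cmod z < 1"
    using assms by (auto simp: pisot_def)
  obtain P :: "int poly" where P: "lead_coeff P = 1" "irreducible (map_poly rat_of_int P)"
    "poly (map_poly of_int P) \<beta> = 0" "rsquarefree (map_poly of_int P :: complex poly)"
    by (rule minimal_polynomial_of_algebraic_int[OF b(2)])
  show ?thesis
  proof (rule that[of P])
    show "poly (map_poly of_int P) (complex_of_real \<beta>) = 0"
    proof -
      have "poly (map_poly of_int P) (complex_of_real \<beta>) = of_real (poly (map_poly of_int P) \<beta>)"
        by (simp add: poly_altdef degree_map_poly coeff_map_poly)
      thus ?thesis using P by simp
    qed
    show "cmod z < 1" if "poly (map_poly of_int P) z = 0" "z \<noteq> complex_of_real \<beta>" for z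
    proof (rule conj)
      show "z \<in> galois_conjugates \<beta>" unfolding galois_conjugates_def
        using that P by (intro CollectI exI[of _ "map_poly rat_of_int P"]) (simp add: map_poly_of_rat_of_int)
    qed (use that in auto)
    show "coeff P 0 \<noteq> 0"
    proof
      assume "coeff P 0 = 0"
      then obtain Q where Q: "P = [:0,1:] * Q" 
        by (cases P) (auto simp: split: if_splits)
      have "map_poly rat_of_int P = [:0,1:] * map_poly rat_of_int Q"
        by (simp add: Q map_poly_of_int_mult map_poly_pCons)
      hence "is_unit [:0,1::rat:] \<or> is_unit (map_poly rat_of_int Q)"
        using P(2) irreducibleD by blast
      hence "degree (map_poly rat_of_int Q) = 0" by (auto simp: is_unit_poly_iff)
      hence "degree Q = 0" by (simp add: degree_map_poly)
      then obtain c where "Q = [:c:]" by (auto elim: degree_eq_zeroE)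
      hence "P = [:0,1:]" using P(1) Q by (cases "c = 0") auto
      thus False using P(3) b by (simp add: map_poly_pCons)
    qed
  qed (use P in auto)
qed

section \<open>Finiteness of the spectrum in bounded intervals\<close>

text \<open>Horner's scheme modulo \<open>P\<close>: one step multiplies by \<open>X\<close>, adds a digit, and cancels the coefficient of
  degree \<open>degree P\<close>. Since \<open>P\<close> is monic the coefficients stay integral.\<close>
lemma reduce_modulo_monic:
  fixes P :: "int poly" and c :: "nat \<Rightarrow> int"
  assumes "lead_coeff P = 1" "degree P > 0"
  shows "\<exists>K :: int poly. degree K < degree P \<and>
           (\<forall>z::complex. poly (map_poly of_int P) z = 0 \<longrightarrow>
              poly (map_poly of_int K) z = (\<Sum>i=1..n. of_int (c i) * z ^ (n - i)))"
proof (induction n)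
  case 0
  show ?case using assms by (intro exI[of _ 0]) simp
next
  case (Suc n)
  then obtain K where K: "degree K < degree P" "\<And>z::complex. poly (map_poly of_int P) z = 0 \<Longrightarrow>
     poly (map_poly of_int K) z = (\<Sum>i=1..n. of_int (c i) * z ^ (n - i))" by blast
  define d where "d = degree P"
  define K' where "K' = pCons (c (Suc n)) K - smult (coeff K (d - 1)) P"
  have d: "d > 0" "coeff P d = 1" using assms by (auto simp: d_def)
  have "coeff K' i = 0" if "i \<ge> d" for i
  proof (cases "i = d")
    case True
    thus ?thesis using d by (simp add: K'_def coeff_pCons split: nat.splits)
  next
    case False
    hence "i > d" "i - 1 > degree K" using that K(1) by (auto simp: d_def)
    thus ?thesis by (auto simp: K'_def coeff_pCons coeff_eq_0 d_def split: nat.splits)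
  qed
  hence "degree K' < d" using d(1)
    by (metis leading_coeff_0_iff degree_0 linorder_not_le)
  moreover have "poly (map_poly of_int K') z = (\<Sum>i=1..Suc n. of_int (c i) * z ^ (Suc n - i))"
    if z: "poly (map_poly of_int P) z = 0" for z :: complex
  proof -
    have "map_poly of_int K' = pCons (of_int (c (Suc n))) (map_poly of_int K)
            - smult (of_int (coeff K (d - 1))) (map_poly of_int P :: complex poly)"
      by (rule poly_eqI) (simp add: K'_def coeff_map_poly coeff_pCons split: nat.splits)
    hence "poly (map_poly of_int K') z = of_int (c (Suc n)) + z * (\<Sum>i=1..n. of_int (c i) * z ^ (n - i))"
      by (simp add: z K(2))
    also have "z * (\<Sum>i=1..n. of_int (c i) * z ^ (n - i)) = (\<Sum>i=1..n. of_int (c i) * z ^ (Suc n - i))"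
      unfolding sum_distrib_left
      by (intro sum.cong) (auto simp: Suc_diff_le)
    finally show ?thesis by simp
  qed
  ultimately show ?case unfolding d_def by blast
qed

lemma finite_int_polys_bounded_coeffs:
  "finite {K :: int poly. degree K < d \<and> (\<forall>j. \<bar>coeff K j\<bar> \<le> M)}" (is "finite ?A")
proof -
  have "inj_on (\<lambda>K. restrict (coeff K) {..<d}) ?A"
  proof (rule inj_onI)
    fix K L assume K: "K \<in> ?A" and L: "L \<in> ?A"
      and eq: "restrict (coeff K) {..<d} = restrict (coeff L) {..<d}"
    have "coeff K j = coeff L j" for j
    proof (cases "j < d")
      case True thus ?thesis using fun_cong[OF eq, of j] by simp
    next
      case False thus ?thesis using K L by (simp add: coeff_eq_0)
    qed
    thus "K = L" by (rule poly_eqI)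
  qed
  moreover have "(\<lambda>K. restrict (coeff K) {..<d}) ` ?A \<subseteq> {..<d} \<rightarrow>\<^sub>E {-M..M}"
    by (force simp: abs_le_iff)
  hence "finite ((\<lambda>K. restrict (coeff K) {..<d}) ` ?A)"
    by (rule finite_subset) (auto intro!: finite_PiE)
  ultimately show ?thesis by (rule finite_imageD[rotated])
qed

text \<open>Lagrange interpolation makes the coefficients linear functions of the values at \<open>d\<close> points, so
  bounded values mean bounded, hence finitely many, integer coefficients.\<close>
lemma finite_int_polys_bounded_values:
  fixes Z :: "complex set"
  assumes Z: "finite Z" "card Z = d" and B: "\<And>z. z \<in> Z \<Longrightarrow> B z \<ge> 0"
  shows "finite {K :: int poly. degree K < d \<and> (\<forall>z\<in>Z. cmod (poly (map_poly of_int K) z) \<le> B z)}"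
    (is "finite ?A")
proof -
  define L where "L = (\<lambda>a. \<Prod>b\<in>Z - {a}. smult (inverse (a - b)) [:- b, 1:])"
  have degL: "degree (L a) < d" if "a \<in> Z" for a
  proof -
    have "degree (L a) \<le> (\<Sum>b\<in>Z - {a}. degree (smult (inverse (a - b)) [:- b, 1:]))"
      unfolding L_def using Z degree_prod_sum_le[of "Z - {a}" "\<lambda>b. smult (inverse (a - b)) [:- b, 1:]"]
      by (simp only: o_def finite_Diff)
    also have "\<dots> \<le> (\<Sum>b\<in>Z - {a}. 1)" by (intro sum_mono) auto
    also have "\<dots> < d" using Z that card_gt_0_iff[of Z] by (auto simp: card_Diff_singleton)
    finally show ?thesis .
  qed
  have Lval: "poly (L a) b = (if a = b then 1 else 0)" if "a \<in> Z" "b \<in> Z" for a b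
  proof -
    have "poly (L a) b = (\<Prod>c\<in>Z - {a}. (b - c) / (a - c))"
      by (simp add: L_def poly_prod divide_inverse algebra_simps)
    thus ?thesis using that Z by auto
  qed
  define M where "M = (\<Sum>j<d. \<Sum>a\<in>Z. B a * cmod (coeff (L a) j))"
  have "?A \<subseteq> {K. degree K < d \<and> (\<forall>j. \<bar>coeff K j\<bar> \<le> \<lceil>M\<rceil>)}"
  proof (safe)
    fix K j assume K: "degree K < d" and Kb: "\<forall>z\<in>Z. cmod (poly (map_poly of_int K) z) \<le> B z"
    define KC where "KC = (map_poly of_int K :: complex poly)"
    have KCd: "degree KC < d" using K by (simp add: KC_def degree_map_poly)
    define D where "D = KC - (\<Sum>a\<in>Z. smult (poly KC a) (L a))"
    have "degree (\<Sum>a\<in>Z. smult (poly KC a) (L a)) < d"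
      using Z degL K by (intro degree_sum_less) (auto intro: le_less_trans[OF degree_smult_le])
    hence "degree D < d" using KCd unfolding D_def by (rule degree_diff_less[rotated])
    moreover have "poly D b = 0" if b: "b \<in> Z" for b
    proof -
      have "(\<Sum>a\<in>Z. poly KC a * poly (L a) b) = (\<Sum>a\<in>Z. if a = b then poly KC b else 0)"
        using b by (intro sum.cong) (auto simp: Lval)
      thus ?thesis using b Z by (simp add: D_def poly_sum)
    qed
    ultimately have "D = 0"
      using Z card_poly_roots_bound[of D] card_mono[OF poly_roots_finite[of D], of Z]
      by (metis (mono_tags, lifting) linorder_not_less mem_Collect_eq order_trans subsetI)
    hence KC_eq: "KC = (\<Sum>a\<in>Z. smult (poly KC a) (L a))" by (simp add: D_def)
    have Mn: "(\<Sum>a\<in>Z. B a * cmod (coeff (L a) j)) \<ge> 0" for j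
      using B by (intro sum_nonneg) auto
    show "\<bar>coeff K j\<bar> \<le> \<lceil>M\<rceil>"
    proof (cases "j < d")
      case True
      have "real_of_int \<bar>coeff K j\<bar> = cmod (coeff KC j)" by (simp add: KC_def coeff_map_poly)
      also have "\<dots> = cmod (\<Sum>a\<in>Z. poly KC a * coeff (L a) j)"
        by (subst KC_eq) (simp add: coeff_sum)
      also have "\<dots> \<le> (\<Sum>a\<in>Z. B a * cmod (coeff (L a) j))"
        using Kb by (intro sum_norm_le) (auto simp: norm_mult KC_def intro!: mult_right_mono)
      also have "\<dots> \<le> M" unfolding M_def
        using True Mn by (intro member_le_sum) auto
      finally show ?thesis by linarith
    next
      case False
      have "M \<ge> 0" unfolding M_def using Mn by (intro sum_nonneg[of "{..<d}"]) simp
      thus ?thesis using False K by (simp add: coeff_eq_0)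
    qed
  qed
  thus ?thesis using finite_int_polys_bounded_coeffs finite_subset by blast
qed

lemma card_roots_rsquarefree:
  fixes p :: "complex poly"
  assumes "rsquarefree p"
  shows "card {z. poly p z = 0} = degree p"
proof -
  have "p \<noteq> 0" using assms by (simp add: rsquarefree_def)
  have "degree (smult (lead_coeff p) (\<Prod>z|poly p z = 0. [:-z, 1:])) = degree p"
    by (simp add: complex_poly_decompose_rsquarefree[OF assms])
  thus ?thesis using \<open>p \<noteq> 0\<close> by (simp add: degree_prod_sum_eq)
qed

text \<open>A point of the spectrum is the value at \<open>\<beta>\<close> of an integer polynomial of degree less than
  \<open>degree P\<close>. In a bounded interval this value is bounded, and at a conjugate \<open>z\<close> the geometric series
  bounds it by \<open>1 / (1 - \<bar>z\<bar>)\<close>.\<close>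
lemma finite_beta_spectrum_bounded:
  assumes "pisot \<beta>"
  shows "finite (beta_spectrum \<beta> \<inter> {-R..R})"
proof -
  obtain P :: "int poly" where P: "lead_coeff P = 1" "poly (map_poly of_int P) (complex_of_real \<beta>) = 0"
    "coeff P 0 \<noteq> 0" "rsquarefree (map_poly of_int P :: complex poly)"
    "\<And>z::complex. poly (map_poly of_int P) z = 0 \<Longrightarrow> z \<noteq> complex_of_real \<beta> \<Longrightarrow> cmod z < 1"
    by (rule pisot_minimal_polynomial[OF assms]) blast
  define Z where "Z = {z::complex. poly (map_poly of_int P) z = 0}"
  have cardZ: "card Z = degree P" unfolding Z_def
    using card_roots_rsquarefree[OF P(4)] by (simp add: degree_map_poly)
  have finZ: "finite Z" unfolding Z_def using P(4) by (intro poly_roots_finite) (auto simp: rsquarefree_def)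
  have "complex_of_real \<beta> \<in> Z" using P(2) by (simp add: Z_def)
  hence deg: "degree P > 0" using finZ cardZ by (metis card_gt_0_iff empty_iff)
  define B where "B = (\<lambda>z. if z = complex_of_real \<beta> then \<bar>R\<bar> else 1 / (1 - cmod z))"
  define A where "A = {K :: int poly. degree K < degree P \<and> (\<forall>z\<in>Z. cmod (poly (map_poly of_int K) z) \<le> B z)}"
  have "finite A" unfolding A_def
    using finZ cardZ P(5) by (intro finite_int_polys_bounded_values) (auto simp: B_def Z_def less_eq_real_def)
  moreover have "beta_spectrum \<beta> \<inter> {-R..R} \<subseteq> (\<lambda>K. Re (poly (map_poly of_int K) (complex_of_real \<beta>))) ` A"
  proof
    fix x assume x: "x \<in> beta_spectrum \<beta> \<inter> {-R..R}"
    then obtain n c where c: "c \<in> {1..n} \<rightarrow>\<^sub>E {-1, 0, 1 :: real}" and xs: "x = (\<Sum>i=1..n. c i * \<beta> ^ (n - i))"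
      by (auto simp: beta_spectrum_def)
    define ci where "ci = (\<lambda>i. \<lfloor>c i\<rfloor>)"
    have ci: "real_of_int (ci i) = c i" "\<bar>ci i\<bar> \<le> 1" if "i \<in> {1..n}" for i
    proof -
      have "c i \<in> {-1,0,1}" using c that by (rule PiE_mem)
      then obtain k :: int where "k \<in> {-1,0,1}" "c i = of_int k" by force
      thus "real_of_int (ci i) = c i" "\<bar>ci i\<bar> \<le> 1" by (auto simp: ci_def)
    qed
    obtain K where K: "degree K < degree P" "\<And>z::complex. poly (map_poly of_int P) z = 0 \<Longrightarrow>
              poly (map_poly of_int K) z = (\<Sum>i=1..n. of_int (ci i) * z ^ (n - i))"
      using reduce_modulo_monic[OF P(1) deg, of ci n] by blast
    have Kb: "poly (map_poly of_int K) (complex_of_real \<beta>) = of_real x"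
    proof -
      have "(\<Sum>i=1..n. of_int (ci i) * complex_of_real \<beta> ^ (n - i)) = of_real (\<Sum>i=1..n. of_int (ci i) * \<beta> ^ (n - i))"
        by simp
      also have "(\<Sum>i=1..n. of_int (ci i) * \<beta> ^ (n - i)) = x" unfolding xs by (intro sum.cong) (auto simp: ci)
      finally show ?thesis using K(2) P(2) by simp
    qed
    have "cmod (poly (map_poly of_int K) z) \<le> B z" if z: "z \<in> Z" for z
    proof (cases "z = complex_of_real \<beta>")
      case True
      thus ?thesis using x by (simp add: Kb B_def abs_le_iff)
    next
      case False
      hence z1: "cmod z < 1" using P(5) z by (simp add: Z_def)
      have "cmod (poly (map_poly of_int K) z) \<le> (\<Sum>i=1..n. cmod z ^ (n - i))"
      proof -
        have "cmod (of_int (ci i) * z ^ (n - i)) \<le> cmod z ^ (n - i)" if "i \<in> {1..n}" for i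
          using ci(2)[OF that] by (simp add: norm_mult norm_power mult_left_le_one_le)
        thus ?thesis using z K(2)[of z] by (auto simp: Z_def intro!: sum_norm_le)
      qed
      also have "\<dots> = (\<Sum>i<n. cmod z ^ i)"
        by (rule sum.reindex_bij_witness[of _ "\<lambda>i. n - i" "\<lambda>i. n - i"]) auto
      also have "\<dots> \<le> (\<Sum>i. cmod z ^ i)" using z1 by (intro sum_le_suminf) auto
      also have "\<dots> = B z" using z1 False by (simp add: B_def suminf_geometric)
      finally show ?thesis .
    qed
    hence "K \<in> A" using K(1) by (simp add: A_def)
    moreover have "x = Re (poly (map_poly of_int K) (complex_of_real \<beta>))" by (simp add: Kb)
    ultimately show "x \<in> (\<lambda>K. Re (poly (map_poly of_int K) (complex_of_real \<beta>))) ` A" by blast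
  qed
  ultimately show ?thesis using finite_surj by blast
qed

section \<open>Pisot numbers are bounded away from 1\<close>

text \<open>Multiplication by \<open>(X - \<alpha>) / (1 - cnj \<alpha> X)\<close> is an isometry of the Hardy space. For truncated sums the
  squares telescope, and only the boundary term \<open>(1 - \<bar>\<alpha>\<bar>\<^sup>2) \<bar>v\<^sub>N\<bar>\<^sup>2\<close> with
  \<open>v = h / (1 - cnj \<alpha> X)\<close> is lost.\<close>
lemma blaschke_factor_contraction:
  fixes u h :: "complex fps"
  assumes \<alpha>: "cmod \<alpha> < 1"
    and eq: "u * (1 - fps_const (cnj \<alpha>) * fps_X) = h * (fps_X - fps_const \<alpha>)"
  shows "(\<Sum>n\<le>N. (cmod (u $ n))\<^sup>2) \<le> (\<Sum>n\<le>N. (cmod (h $ n))\<^sup>2)"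
proof -
  define D where "D = 1 - fps_const (cnj \<alpha>) * fps_X"
  define v where "v = h * inverse D"
  have D0: "D $ 0 \<noteq> 0" by (simp add: D_def)
  hence hv: "h = v * D" by (simp add: v_def mult.assoc inverse_mult_eq_1)
  have "D \<noteq> 0" using D0 by auto
  moreover have "u * D = v * (fps_X - fps_const \<alpha>) * D" using eq hv by (simp add: D_def mult_ac)
  ultimately have uv: "u = v * (fps_X - fps_const \<alpha>)" by simp
  have h_eq: "h = v - fps_const (cnj \<alpha>) * (fps_X * v)" unfolding hv D_def by (simp add: algebra_simps)
  have u_eq: "u = fps_X * v - fps_const \<alpha> * v" unfolding uv by (simp add: algebra_simps)
  have h0: "h $ 0 = v $ 0" and hS: "h $ Suc n = v $ Suc n - cnj \<alpha> * v $ n" for n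
    unfolding h_eq by simp_all
  have u0: "u $ 0 = - \<alpha> * v $ 0" and uS: "u $ Suc n = v $ n - \<alpha> * v $ Suc n" for n
    unfolding u_eq by simp_all
  have key: "(cmod (x - \<alpha> * y))\<^sup>2 - (cmod (y - cnj \<alpha> * x))\<^sup>2 = ((cmod x)\<^sup>2 - (cmod y)\<^sup>2) * (1 - (cmod \<alpha>)\<^sup>2)" for x y
    unfolding cmod_power2 by (simp add: power2_eq_square algebra_simps)
  have "(\<Sum>n\<le>N. (cmod (u $ n))\<^sup>2) = (\<Sum>n\<le>N. (cmod (h $ n))\<^sup>2) - (cmod (v $ N))\<^sup>2 * (1 - (cmod \<alpha>)\<^sup>2)"
  proof (induction N)
    case 0
    show ?case by (simp add: h0 u0 norm_mult power_mult_distrib algebra_simps)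
  next
    case (Suc N)
    thus ?case using key[of "v $ N" "v $ Suc N"] by (simp add: hS uS algebra_simps)
  qed
  moreover have "(cmod \<alpha>)\<^sup>2 \<le> 1" using \<alpha> by (simp add: power_le_one)
  ultimately show ?thesis by simp
qed

lemma blaschke_product_contraction:
  fixes U H :: "complex fps"
  assumes "finite A" "\<And>\<alpha>. \<alpha> \<in> A \<Longrightarrow> cmod \<alpha> < 1"
    and "U * (\<Prod>\<alpha>\<in>A. 1 - fps_const (cnj \<alpha>) * fps_X) = H * (\<Prod>\<alpha>\<in>A. fps_X - fps_const \<alpha>)"
  shows "(\<Sum>n\<le>N. (cmod (U $ n))\<^sup>2) \<le> (\<Sum>n\<le>N. (cmod (H $ n))\<^sup>2)"
  using assms
proof (induction A arbitrary: H rule: finite_induct)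
  case empty
  thus ?case by simp
next
  case (insert \<alpha> A)
  define D where "D = 1 - fps_const (cnj \<alpha>) * fps_X"
  have D0: "D $ 0 \<noteq> 0" by (simp add: D_def)
  hence Dnz: "D \<noteq> 0" by auto
  define h where "h = H * (fps_X - fps_const \<alpha>) * inverse D"
  have hD: "h * D = H * (fps_X - fps_const \<alpha>)" using D0 by (simp add: h_def mult.assoc inverse_mult_eq_1)
  have "U * (\<Prod>\<alpha>\<in>A. 1 - fps_const (cnj \<alpha>) * fps_X) * D = h * (\<Prod>\<alpha>\<in>A. fps_X - fps_const \<alpha>) * D"
    using insert hD by (simp add: D_def mult_ac)
  hence "U * (\<Prod>\<alpha>\<in>A. 1 - fps_const (cnj \<alpha>) * fps_X) = h * (\<Prod>\<alpha>\<in>A. fps_X - fps_const \<alpha>)"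
    using Dnz by simp
  hence "(\<Sum>n\<le>N. (cmod (U $ n))\<^sup>2) \<le> (\<Sum>n\<le>N. (cmod (h $ n))\<^sup>2)"
    using insert by (intro insert.IH) auto
  also have "\<dots> \<le> (\<Sum>n\<le>N. (cmod (H $ n))\<^sup>2)"
    using insert.prems(1) hD by (intro blaschke_factor_contraction[of \<alpha>]) (auto simp: D_def)
  finally show ?case .
qed

text \<open>Each step from \<open>a\<^sub>n\<close> to \<open>a\<^sub>n\<^sub>+\<^sub>1\<close> costs \<open>(a\<^sub>n\<^sub>+\<^sub>1 - \<beta> a\<^sub>n)\<^sup>2\<close>, out of a budget \<open>\<beta>\<^sup>2 \<le> 1.21\<close>. If
  \<open>a\<^sub>1 > 0\<close>, the budget pays for one step from \<open>1\<close> to \<open>2\<close> (cost at least \<open>0.81\<close>) but not for a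
  further one to \<open>3\<close> (cost at least \<open>0.64\<close>), and every decrease is too expensive. So the sequence stays in
  \<open>{1, 2}\<close>, where each step costs at least \<open>(\<beta> - 1)\<^sup>2\<close>, and the budget runs out. If \<open>a\<^sub>1 \<le> 0\<close>, the
  first step already uses up the budget.\<close>
lemma integer_sequence_near_geometric:
  fixes a :: "nat \<Rightarrow> int" and \<beta> :: real
  assumes \<beta>: "1 < \<beta>" "\<beta> \<le> 11/10" and a0: "a 0 = 1"
    and bound: "\<And>N. (\<Sum>n<N. (a (Suc n) - \<beta> * a n)\<^sup>2) \<le> \<beta>\<^sup>2"
  shows "a (Suc n) = 0"
proof -
  define S where "S = (\<lambda>N. \<Sum>n<N. (a (Suc n) - \<beta> * a n)\<^sup>2)"
  have S_Suc: "S (Suc n) = S n + (a (Suc n) - \<beta> * a n)\<^sup>2" for n by (simp add: S_def)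
  have S_le: "S n \<le> \<beta>\<^sup>2" for n using bound by (simp add: S_def)
  have \<beta>2: "\<beta>\<^sup>2 \<le> (11/10)\<^sup>2" using \<beta> by (intro power_mono) auto
  hence \<beta>2': "\<beta>\<^sup>2 \<le> 121/100" by (simp add: power2_eq_square)
  have le_cost: "(a (Suc n) - \<beta> * a n)\<^sup>2 \<ge> y\<^sup>2"
    if "\<beta> * a n - a (Suc n) \<ge> y \<or> a (Suc n) - \<beta> * a n \<ge> y" "y \<ge> 0" for n y
    using that(1)
  proof
    assume "\<beta> * a n - a (Suc n) \<ge> y"
    hence "y\<^sup>2 \<le> (\<beta> * a n - a (Suc n))\<^sup>2" using that by (intro power_mono) auto
    thus ?thesis by (simp add: power2_commute)
  qed (use that in \<open>auto intro!: power_mono\<close>)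
  have a1: "a 1 \<le> 0"
  proof (rule ccontr)
    assume a1: "\<not> a 1 \<le> 0"
    define e where "e = (\<beta> - 1)\<^sup>2"
    have e: "e > 0" "e \<le> 1/100"
    proof -
      show "e > 0" using \<beta> by (simp add: e_def)
      have "e \<le> (1/10)\<^sup>2" unfolding e_def using \<beta> by (intro power_mono) auto
      thus "e \<le> 1/100" by (simp add: power2_eq_square)
    qed
    have inv: "(a (Suc n) = 1 \<or> a (Suc n) = 2 \<and> S (Suc n) \<ge> 81/100) \<and> S (Suc n) \<ge> real (Suc n) * e" for n
    proof (induction n)
      case 0
      have S1: "S 1 = (a 1 - \<beta>)\<^sup>2" by (simp add: S_def a0)
      consider "a 1 = 1" | "a 1 = 2" | "a 1 \<ge> 3" using a1 by linarith
      thus ?case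
      proof cases
        case 1
        thus ?thesis using S1 by (simp add: e_def power2_commute)
      next
        case 2
        have "(9/10)\<^sup>2 \<le> (2 - \<beta>)\<^sup>2" using \<beta> by (intro power_mono) auto
        thus ?thesis using S1 2 e by (simp add: power2_eq_square)
      next
        case 3
        have "(19/10)\<^sup>2 \<le> (a 1 - \<beta>)\<^sup>2" using \<beta> 3 by (intro power_mono) auto
        thus ?thesis using S1 S_le[of 1] \<beta>2' by (simp add: power2_eq_square)
      qed
    next
      case (Suc n)
      define m where "m = Suc n"
      have Sm: "S m \<ge> real m * e" "S m \<ge> 0"
        using Suc unfolding m_def by (auto simp: S_def sum_nonneg)
      have Sm0: "S m > 0" 
      proof -
        have "0 < real m * e" using e by (simp add: m_def)
        thus ?thesis using Sm(1) by linarith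
      qed
      have cost: "(a (Suc m) - \<beta> * a m)\<^sup>2 \<le> \<beta>\<^sup>2 - S m" using S_le[of "Suc m"] S_Suc[of m] by linarith
      consider "a m = 1" | "a m = 2" "S m \<ge> 81/100" using Suc unfolding m_def by auto
      thus ?case
      proof cases
        case 1
        consider "a (Suc m) \<le> 0" | "a (Suc m) = 1" | "a (Suc m) = 2" | "a (Suc m) \<ge> 3" by linarith
        thus ?thesis
        proof cases
          case z: 1
          hence "\<beta>\<^sup>2 \<le> (a (Suc m) - \<beta> * a m)\<^sup>2" using 1 \<beta> z by (intro le_cost) auto
          thus ?thesis using cost Sm0 by linarith
        next
          case 2
          thus ?thesis using 1 Sm S_Suc[of m] unfolding m_def[symmetric]
            by (simp add: e_def power2_commute algebra_simps)
        next
          case 3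
          hence "(9/10)\<^sup>2 \<le> (a (Suc m) - \<beta> * a m)\<^sup>2" using 1 \<beta> by (intro le_cost) auto
          hence "S (Suc m) \<ge> S m + 81/100" using S_Suc[of m] by (simp add: power2_eq_square)
          thus ?thesis using 3 Sm e unfolding m_def[symmetric] by (simp add: algebra_simps)
        next
          case 4
          hence "(19/10)\<^sup>2 \<le> (a (Suc m) - \<beta> * a m)\<^sup>2" using 1 \<beta> by (intro le_cost) auto
          thus ?thesis using cost Sm \<beta>2' by (simp add: power2_eq_square)
        qed
      next
        case 2
        consider "a (Suc m) \<le> 1" | "a (Suc m) = 2" | "a (Suc m) \<ge> 3" by linarith
        thus ?thesis
        proof cases
          case 1
          hence "1\<^sup>2 \<le> (a (Suc m) - \<beta> * a m)\<^sup>2" using 2 \<beta> by (intro le_cost) auto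
          thus ?thesis using cost 2 \<beta>2' by simp
        next
          case z: 2
          have "(a (Suc m) - \<beta> * a m)\<^sup>2 = 4 * e" using 2 z by (simp add: e_def power2_eq_square algebra_simps)
          hence "S (Suc m) = S m + 4 * e" using S_Suc[of m] by simp
          thus ?thesis using 2 z Sm e unfolding m_def[symmetric] by (simp add: algebra_simps)
        next
          case 3
          hence "(8/10)\<^sup>2 \<le> (a (Suc m) - \<beta> * a m)\<^sup>2" using 2 \<beta> by (intro le_cost) auto
          thus ?thesis using cost 2 \<beta>2' by (simp add: power2_eq_square)
        qed
      qed
    qed
    obtain n :: nat where "\<beta>\<^sup>2 < real n * e" using e reals_Archimedean3 by blast
    moreover have "real n * e \<le> real (Suc n) * e" using e by (simp add: algebra_simps)
    ultimately show False using inv[of n] S_le[of "Suc n"] by linarith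
  qed
  have "\<beta>\<^sup>2 \<le> (a (Suc 0) - \<beta> * a 0)\<^sup>2" using a1 a0 \<beta> by (intro le_cost) auto
  hence S1: "S 1 = \<beta>\<^sup>2" using S_le[of 1] by (simp add: S_def)
  have "(a 1 - \<beta>)\<^sup>2 = \<beta>\<^sup>2" using S1 by (simp add: S_def a0)
  hence "\<bar>a 1 - \<beta>\<bar> = \<bar>\<beta>\<bar>" by (simp add: power2_eq_iff abs_eq_iff)
  hence a1': "a 1 = 0" using a1 \<beta> by auto
  have "S (Suc n) = \<beta>\<^sup>2 \<and> a (Suc n) = 0"
  proof (induction n)
    case 0
    thus ?case using S1 a1' by simp
  next
    case (Suc n)
    have "(a (Suc (Suc n)) - \<beta> * a (Suc n))\<^sup>2 \<le> 0" using S_le[of "Suc (Suc n)"] S_Suc[of "Suc n"] Suc by linarith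
    hence "(a (Suc (Suc n)) - \<beta> * a (Suc n))\<^sup>2 = 0" by (simp add: antisym)
    thus ?case using Suc S_Suc[of "Suc n"] by simp
  qed
  thus ?thesis by simp
qed

lemma reflect_poly_map_poly_of_int:
  "reflect_poly (map_poly of_int P :: complex poly) = map_poly of_int (reflect_poly P)"
  by (rule poly_eqI) (simp add: coeff_reflect_poly coeff_map_poly degree_map_poly)

text \<open>The roots of \<open>P\<close> are closed under inversion, and all but \<open>\<beta>\<close> lie in the open unit disc, which leaves
  only \<open>\<beta>\<close> and \<open>1 / \<beta>\<close>. Their sum is then an integer greater than \<open>2\<close>, hence at least
  \<open>3\<close>, and \<open>1 / \<beta> < 1\<close>.\<close>
lemma reciprocal_pisot_polynomial_gap:
  fixes P :: "int poly"
  assumes lead: "lead_coeff P = 1" and root: "poly (map_poly of_int P) (complex_of_real \<beta>) = 0"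
    and P0: "coeff P 0 \<noteq> 0" and sqf: "rsquarefree (map_poly of_int P :: complex poly)"
    and small: "\<And>z::complex. poly (map_poly of_int P) z = 0 \<Longrightarrow> z \<noteq> complex_of_real \<beta> \<Longrightarrow> cmod z < 1"
    and recip: "reflect_poly P = smult c P" and \<beta>: "\<beta> > 1"
  shows "\<beta> > 2"
proof -
  define PC where "PC = (map_poly of_int P :: complex poly)"
  define Z where "Z = {z. poly PC z = 0}"
  have "reflect_poly PC = smult (of_int c) PC"
  proof -
    have "reflect_poly PC = map_poly of_int (reflect_poly P)"
      unfolding PC_def by (rule reflect_poly_map_poly_of_int)
    also have "\<dots> = smult (of_int c) PC" unfolding recip by (rule poly_eqI) (simp add: PC_def coeff_map_poly)
    finally show ?thesis .
  qed
  moreover have "poly PC 0 \<noteq> 0" using P0 by (simp add: PC_def poly_0_coeff_0 coeff_map_poly)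
  ultimately have inv: "inverse z \<in> Z" "z \<noteq> 0" if "z \<in> Z" for z
  proof -
    show nz: "z \<noteq> 0" using that \<open>poly PC 0 \<noteq> 0\<close> by (auto simp: Z_def)
    have "poly (reflect_poly PC) z = 0" using that \<open>reflect_poly PC = _\<close> by (simp add: Z_def)
    thus "inverse z \<in> Z" using nz by (simp add: poly_reflect_poly_nz Z_def)
  qed
  have \<beta>Z: "complex_of_real \<beta> \<in> Z" using root by (simp add: Z_def PC_def)
  have Z_eq: "Z = {complex_of_real \<beta>, complex_of_real (inverse \<beta>)}"
  proof (intro equalityI subsetI)
    fix z assume z: "z \<in> Z"
    show "z \<in> {complex_of_real \<beta>, complex_of_real (inverse \<beta>)}"
    proof (cases "z = complex_of_real \<beta>")
      case False
      hence "cmod z < 1" using small z by (simp add: Z_def PC_def)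
      hence "cmod (inverse z) > 1" using inv(2)[OF z] by (simp add: norm_inverse one_less_inverse)
      hence "inverse z = complex_of_real \<beta>"
        using small[of "inverse z"] inv(1)[OF z] by (force simp: Z_def PC_def)
      hence "z = inverse (complex_of_real \<beta>)" by (metis inverse_inverse_eq)
      thus ?thesis by simp
    qed auto
  next
    fix z assume "z \<in> {complex_of_real \<beta>, complex_of_real (inverse \<beta>)}"
    thus "z \<in> Z" using \<beta>Z inv(1)[OF \<beta>Z] by auto
  qed
  have ne: "complex_of_real \<beta> \<noteq> complex_of_real (inverse \<beta>)"
    using \<beta> by (metis of_real_eq_iff inverse_less_1_iff less_irrefl order_less_trans)
  have "PC = (\<Prod>z\<in>Z. [:- z, 1:])"
    using complex_poly_decompose_rsquarefree[OF sqf] lead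
    by (simp add: PC_def Z_def degree_map_poly coeff_map_poly)
  hence "PC = [:- complex_of_real \<beta>, 1:] * [:- complex_of_real (inverse \<beta>), 1:]"
    using ne by (simp add: Z_eq)
  hence "coeff PC 1 = complex_of_real (- (\<beta> + inverse \<beta>))" by simp
  hence "complex_of_real (- (\<beta> + inverse \<beta>)) = complex_of_real (of_int (coeff P 1))"
    by (simp add: PC_def coeff_map_poly)
  hence k: "\<beta> + inverse \<beta> = of_int (- coeff P 1)" by (simp only: of_real_eq_iff)
  have "(\<beta> - 1)\<^sup>2 > 0" using \<beta> by simp
  hence "\<beta> * (\<beta> + inverse \<beta>) > \<beta> * 2" using \<beta> by (simp add: power2_eq_square algebra_simps)
  hence "\<beta> + inverse \<beta> > 2" using \<beta> by simp
  hence "2 < - coeff P 1" unfolding k by simp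
  hence "\<beta> + inverse \<beta> \<ge> 3" unfolding k by simp
  moreover have "inverse \<beta> < 1" using \<beta> by (simp add: inverse_less_1_iff)
  ultimately show ?thesis by linarith
qed

text \<open>The constant \<open>11/10\<close> is not optimal (the least Pisot number is about \<open>1.3247\<close>); any bound above
  \<open>1\<close> serves the purpose.\<close>
lemma pisot_gap:
  assumes "pisot \<beta>"
  shows "\<beta> > 11/10"
proof (rule ccontr)
  assume "\<not> \<beta> > 11/10"
  hence \<beta>: "1 < \<beta>" "\<beta> \<le> 11/10" using assms by (auto simp: pisot_def)
  obtain P :: "int poly" where P: "lead_coeff P = 1" "poly (map_poly of_int P) (complex_of_real \<beta>) = 0"
    "coeff P 0 \<noteq> 0" "rsquarefree (map_poly of_int P :: complex poly)"
    "\<And>z::complex. poly (map_poly of_int P) z = 0 \<Longrightarrow> z \<noteq> complex_of_real \<beta> \<Longrightarrow> cmod z < 1"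
    by (rule pisot_minimal_polynomial[OF assms]) blast
  define PC where "PC = (map_poly of_int P :: complex poly)"
  define Z where "Z = {z. poly PC z = 0} - {complex_of_real \<beta>}"
  have finZ: "finite {z. poly PC z = 0}"
    unfolding PC_def using P(4) by (intro poly_roots_finite) (auto simp: rsquarefree_def)
  have insZ: "{z. poly PC z = 0} = insert (complex_of_real \<beta>) Z" "complex_of_real \<beta> \<notin> Z"
    using P(2) by (auto simp: Z_def PC_def)
  have PC_prod: "PC = [:- complex_of_real \<beta>, 1:] * (\<Prod>z\<in>Z. [:- z, 1:])"
  proof -
    have "PC = (\<Prod>z|poly PC z = 0. [:- z, 1:])"
      using complex_poly_decompose_rsquarefree[OF P(4)] P(1)
      by (simp add: PC_def degree_map_poly coeff_map_poly)
    thus ?thesis unfolding insZ(1) using insZ finZ by simp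
  qed
  have nz: "z \<noteq> 0" if "z \<in> Z" for z
    using that P(3) by (auto simp: Z_def PC_def poly_0_coeff_0 coeff_map_poly)
  have refl1: "reflect_poly [:- z, 1:] = [:1, - z:]" if "z \<noteq> 0" for z :: complex
    using that by (simp add: reflect_poly_def)
  \<comment> \<open>Complex conjugation permutes the roots other than \<open>\<beta>\<close>; this turns the factors \<open>1 - zX\<close> into the denominators of Blaschke factors.\<close>
  have R_prod: "reflect_poly PC = [:1, - complex_of_real \<beta>:] * (\<Prod>z\<in>Z. [:1, - cnj z:])"
  proof -
    have "reflect_poly PC = [:1, - complex_of_real \<beta>:] * (\<Prod>z\<in>Z. [:1, - z:])"
      unfolding PC_prod using nz \<beta> by (simp only: reflect_poly_mult reflect_poly_prod refl1 of_real_eq_0_iff) (simp add: refl1 cong: prod.cong)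
    also have "(\<Prod>z\<in>Z. [:1, - z:]) = (\<Prod>z\<in>Z. [:1, - cnj z:])"
    proof (rule prod.reindex_bij_witness[of _ cnj cnj])
      have "cnj z \<in> Z" if "z \<in> Z" for z
      proof -
        have "poly PC (cnj z) = cnj (poly PC z)"
          by (simp add: PC_def poly_altdef coeff_map_poly)
        thus ?thesis using that by (auto simp: Z_def complex_cnj_cancel_iff) (metis complex_cnj_cnj complex_cnj_complex_of_real)
      qed
      thus "z \<in> Z \<Longrightarrow> cnj z \<in> Z" "z \<in> Z \<Longrightarrow> cnj z \<in> Z" for z by auto
    qed auto
    finally show ?thesis .
  qed
  define R where "R = fps_of_poly (reflect_poly P)"
  have R0: "R $ 0 = 1" using P(1) by (simp add: R_def)
  \<comment> \<open>The quotient \<open>P / P\<^sup>*\<close> is a power series over the integers because \<open>P\<^sup>*\<close> has constant coefficient \<open>1\<close>.\<close>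
  define F where "F = fps_of_poly P * fps_left_inverse R 1"
  have FR: "F * R = fps_of_poly P"
    unfolding F_def mult.assoc using fps_left_inverse[of 1 R] R0 by (simp only: mult_1_left mult_1_right)
  define FC where "FC = Abs_fps (\<lambda>n. complex_of_int (F $ n))"
  have FC_R: "FC * fps_of_poly (reflect_poly PC) = fps_of_poly PC"
  proof (rule fps_ext)
    fix n
    have "(FC * fps_of_poly (reflect_poly PC)) $ n = of_int ((F * R) $ n)"
      by (simp add: fps_mult_nth FC_def R_def PC_def reflect_poly_map_poly_of_int coeff_map_poly)
    also have "\<dots> = fps_of_poly PC $ n" by (simp add: FR PC_def coeff_map_poly)
    finally show "(FC * fps_of_poly (reflect_poly PC)) $ n = fps_of_poly PC $ n" .
  qed
  define U where "U = FC * (1 - fps_const (complex_of_real \<beta>) * fps_X)"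
  define H where "H = fps_X - fps_const (complex_of_real \<beta>)"
  have lin1: "fps_of_poly [:1, - w:] = 1 - fps_const w * fps_X" for w :: complex
    by (rule fps_ext) (simp add: coeff_pCons split: nat.splits)
  have lin2: "fps_of_poly [:- w, 1:] = fps_X - fps_const w" for w :: complex
    by (rule fps_ext) (simp add: coeff_pCons split: nat.splits)
  have UH: "U * (\<Prod>\<alpha>\<in>Z. 1 - fps_const (cnj \<alpha>) * fps_X) = H * (\<Prod>\<alpha>\<in>Z. fps_X - fps_const \<alpha>)"
  proof -
    have "U * (\<Prod>\<alpha>\<in>Z. 1 - fps_const (cnj \<alpha>) * fps_X) = FC * fps_of_poly (reflect_poly PC)"
      unfolding R_prod fps_of_poly_mult fps_of_poly_prod lin1 U_def by (simp only: mult.assoc)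
    also have "\<dots> = H * (\<Prod>\<alpha>\<in>Z. fps_X - fps_const \<alpha>)"
      unfolding FC_R unfolding PC_prod fps_of_poly_mult fps_of_poly_prod lin2 H_def ..
    finally show ?thesis .
  qed
  have contr: "(\<Sum>n\<le>N. (cmod (U $ n))\<^sup>2) \<le> (\<Sum>n\<le>N. (cmod (H $ n))\<^sup>2)" for N
    by (rule blaschke_product_contraction[OF _ _ UH])
       (use finZ P(5) in \<open>auto simp: Z_def PC_def\<close>)
  have "(\<Sum>n\<le>N. (cmod (H $ n))\<^sup>2) \<le> 1 + \<beta>\<^sup>2" for N
  proof -
    have "(\<Sum>n\<le>N. (cmod (H $ n))\<^sup>2) \<le> (\<Sum>n\<le>Suc N. (cmod (H $ n))\<^sup>2)" by (intro sum_mono2) auto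
    also have "\<dots> = (\<Sum>n\<in>{0,1}. (cmod (H $ n))\<^sup>2)"
      by (intro sum.mono_neutral_right) (auto simp: H_def)
    also have "\<dots> = 1 + \<beta>\<^sup>2" by (simp add: H_def)
    finally show ?thesis .
  qed
  hence bound0: "(\<Sum>n\<le>N. (cmod (U $ n))\<^sup>2) \<le> 1 + \<beta>\<^sup>2" for N using contr order_trans by blast
  have U_eq: "U = FC - fps_const (complex_of_real \<beta>) * (fps_X * FC)"
    unfolding U_def by (simp add: algebra_simps)
  have U0: "cmod (U $ 0) = \<bar>of_int (F $ 0)\<bar>" by (simp add: U_eq FC_def)
  have US: "(cmod (U $ Suc n))\<^sup>2 = (of_int (F $ Suc n) - \<beta> * of_int (F $ n))\<^sup>2" for n
  proof -
    have "U $ Suc n = complex_of_real (of_int (F $ Suc n) - \<beta> * of_int (F $ n))" by (simp add: U_eq FC_def)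
    thus ?thesis by (simp only: norm_of_real power2_abs)
  qed
  have bound: "(of_int (F $ 0))\<^sup>2 + (\<Sum>n<N. (of_int (F $ Suc n) - \<beta> * of_int (F $ n))\<^sup>2) \<le> 1 + \<beta>\<^sup>2" for N
  proof -
    have "(\<Sum>n<Suc N. (cmod (U $ n))\<^sup>2) \<le> 1 + \<beta>\<^sup>2" using bound0[of N] by (simp add: lessThan_Suc_atMost)
    thus ?thesis unfolding sum.lessThan_Suc_shift US U0 by simp
  qed
  have F0: "F $ 0 = coeff P 0"
    using fps_mult_nth_0[of F R] R0 FR by simp
  have \<beta>2: "\<beta>\<^sup>2 \<le> (11/10)\<^sup>2" using \<beta> by (intro power_mono) auto
  have "(real_of_int (F $ 0))\<^sup>2 < 4" using bound[of 0] \<beta>2 by (simp add: power2_eq_square)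
  hence "\<bar>real_of_int (F $ 0)\<bar> < 2" using abs_le_square_iff[of 2 "real_of_int (F $ 0)"] by simp
  hence c: "F $ 0 = 1 \<or> F $ 0 = -1" using F0 P(3) by linarith
  \<comment> \<open>Normalise the sign so that the sequence starts with \<open>1\<close>.\<close>
  define a where "a = (\<lambda>n. F $ 0 * F $ n)"
  have a_sq: "(of_int (a (Suc n)) - \<beta> * of_int (a n))\<^sup>2 = (of_int (F $ Suc n) - \<beta> * of_int (F $ n))\<^sup>2" for n
    using c by (auto simp: a_def power2_eq_square algebra_simps)
  have "a (Suc n) = 0" for n
  proof (rule integer_sequence_near_geometric[OF \<beta>])
    show "a 0 = 1" using c by (auto simp: a_def)
    show "(\<Sum>n<N. (of_int (a (Suc n)) - \<beta> * of_int (a n))\<^sup>2) \<le> \<beta>\<^sup>2" for N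
      unfolding a_sq using bound[of N] c by auto
  qed
  hence FS: "F $ Suc n = 0" for n using c by (auto simp: a_def)
  have "F = fps_const (F $ 0)"
    by (rule fps_ext) (metis FS fps_nth_fps_const not0_implies_Suc)
  hence "fps_of_poly P = fps_of_poly (smult (F $ 0) (reflect_poly P))"
    using FR by (metis R_def fps_of_poly_smult)
  hence "P = smult (F $ 0) (reflect_poly P)" by (simp add: fps_of_poly_eq_iff)
  hence "reflect_poly P = smult (F $ 0) P" using c by (metis abs_eq_iff' minus_minus mult_minus_left mult_1 smult_1_left smult_minus_left smult_smult mult_minus1_right)
  from reciprocal_pisot_polynomial_gap[OF P(1-4) P(5) this \<beta>(1)] have "\<beta> > 2" by simp
  thus False using \<beta> by simp
qed

section \<open>Counting pairs of words by their difference\<close>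

text \<open>With \<open>r(y)\<close> the size of the fibre over \<open>y\<close>, the left side is \<open>\<Sum> r(y + x) r(y)\<close> and the right side
  is \<open>\<Sum> r(y)\<^sup>2\<close>; the inequality is \<open>2 r(y + x) r(y) \<le> r(y + x)\<^sup>2 + r(y)\<^sup>2\<close>, summed.\<close>
lemma card_shifted_collisions_le:
  fixes f :: "'a \<Rightarrow> real"
  assumes "finite A"
  shows "card {(a, b). a \<in> A \<and> b \<in> A \<and> f a - f b = x} \<le> card {(a, b). a \<in> A \<and> b \<in> A \<and> f a - f b = 0}"
proof -
  define r where "r = (\<lambda>y. card {a \<in> A. f a = y})"
  have fin: "finite {a \<in> A. P a}" for P using assms by simp
  have cnt: "card {(a, b). a \<in> A \<and> b \<in> A \<and> f a - f b = x} = (\<Sum>y\<in>f ` A. r (y + x) * r y)" for x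
  proof -
    have "{(a, b). a \<in> A \<and> b \<in> A \<and> f a - f b = x} = (\<Union>y\<in>f ` A. {a \<in> A. f a = y + x} \<times> {b \<in> A. f b = y})"
      by (auto simp: algebra_simps)
    also have "card \<dots> = (\<Sum>y\<in>f ` A. card ({a \<in> A. f a = y + x} \<times> {b \<in> A. f b = y}))"
      using assms by (intro card_UN_disjoint) auto
    finally show ?thesis by (simp add: r_def card_cartesian_product)
  qed
  have sq: "(\<Sum>y\<in>f ` A. r (y + x) * r (y + x)) \<le> (\<Sum>y\<in>f ` A. r y * r y)"
  proof -
    have "(\<Sum>y\<in>f ` A. r (y + x) * r (y + x)) = (\<Sum>y\<in>(\<lambda>y. y + x) ` f ` A. r y * r y)"
      by (subst sum.reindex) (auto simp: inj_on_def)
    also have "\<dots> = (\<Sum>y\<in>(\<lambda>y. y + x) ` f ` A \<inter> f ` A. r y * r y)"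
    proof (rule sum.mono_neutral_right)
      show "\<forall>y\<in>(\<lambda>y. y + x) ` f ` A - (\<lambda>y. y + x) ` f ` A \<inter> f ` A. r y * r y = 0"
      proof
        fix y assume "y \<in> (\<lambda>y. y + x) ` f ` A - (\<lambda>y. y + x) ` f ` A \<inter> f ` A"
        hence "{a \<in> A. f a = y} = {}" by blast
        thus "r y * r y = 0" by (simp only: r_def card.empty)
      qed
    qed (use assms in auto)
    also have "\<dots> \<le> (\<Sum>y\<in>f ` A. r y * r y)" using assms by (intro sum_mono2) auto
    finally show ?thesis .
  qed
  have "2 * (\<Sum>y\<in>f ` A. r (y + x) * r y) \<le> (\<Sum>y\<in>f ` A. r (y + x) * r (y + x) + r y * r y)"
    unfolding sum_distrib_left
  proof (rule sum_mono)
    fix y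
    have "0 \<le> (int (r (y + x)) - int (r y))\<^sup>2" by simp
    hence "2 * (int (r (y + x)) * int (r y)) \<le> int (r (y + x)) * int (r (y + x)) + int (r y) * int (r y)"
      by (simp add: power2_eq_square algebra_simps)
    thus "2 * (r (y + x) * r y) \<le> r (y + x) * r (y + x) + r y * r y"
      by (metis (mono_tags) of_nat_mult of_nat_add of_nat_le_iff of_nat_numeral)
  qed
  also have "\<dots> \<le> (\<Sum>y\<in>f ` A. r y * r y) + (\<Sum>y\<in>f ` A. r y * r y)" using sq by (simp add: sum.distrib)
  finally have "2 * (\<Sum>y\<in>f ` A. r (y + x) * r y) \<le> 2 * (\<Sum>y\<in>f ` A. r (y + 0) * r y)" by simp
  thus ?thesis by (simp only: cnt mult_le_cancel1)
qed

lemma num_reps_le_num_reps_0: "num_reps \<beta> n x \<le> num_reps \<beta> n 0"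
proof -
  have "num_reps \<beta> n x = card {(a, b). a \<in> {1..n} \<rightarrow>\<^sub>E {0, 1 :: real} \<and> b \<in> {1..n} \<rightarrow>\<^sub>E {0, 1 :: real} \<and>
      (\<Sum>i=1..n. a i * \<beta> ^ (n - i)) - (\<Sum>i=1..n. b i * \<beta> ^ (n - i)) = x}" for x
    by (simp add: num_reps_def left_diff_distrib sum_subtractf)
  thus ?thesis by (simp only:) (intro card_shifted_collisions_le finite_PiE; simp)
qed

lemma num_reps_0: "num_reps \<beta> 0 x = (if x = 0 then 1 else 0)"
proof -
  have "{(a, b). a \<in> {1..0::nat} \<rightarrow>\<^sub>E {0, 1 :: real} \<and> b \<in> {1..0::nat} \<rightarrow>\<^sub>E {0, 1 :: real} \<and>
      (\<Sum>i=1..0. (a i - b i) * \<beta> ^ (0 - i)) = x} = (if x = 0 then {(\<lambda>_. undefined, \<lambda>_. undefined)} else {})"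
    by auto
  thus ?thesis by (simp add: num_reps_def)
qed

text \<open>Splitting off the last digits \<open>s\<close> and \<open>t\<close> of the two words: the difference \<open>s - t\<close> takes the value
  \<open>0\<close> twice and each of \<open>1\<close>, \<open>-1\<close> once.\<close>
lemma num_reps_Suc:
  assumes "\<beta> \<noteq> 0"
  shows "num_reps \<beta> (Suc n) x = num_reps \<beta> n ((x - 1) / \<beta>) + 2 * num_reps \<beta> n (x / \<beta>) + num_reps \<beta> n ((x + 1) / \<beta>)"
proof -
  define S where "S = (\<lambda>n x. {(a, b). a \<in> {1..n} \<rightarrow>\<^sub>E {0, 1 :: real} \<and> b \<in> {1..n} \<rightarrow>\<^sub>E {0, 1 :: real} \<and>
                   (\<Sum>i=1..n. (a i - b i) * \<beta> ^ (n - i)) = x})"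
  have N: "num_reps \<beta> n x = card (S n x)" for n x by (simp add: num_reps_def S_def)
  have finS: "finite (S n x)" for n x
    by (rule finite_subset[of _ "({1..n} \<rightarrow>\<^sub>E {0, 1}) \<times> ({1..n} \<rightarrow>\<^sub>E {0, 1})"])
       (auto simp: S_def intro!: finite_PiE)
  define D where "D = {0, 1 :: real} \<times> {0, 1 :: real}"
  have ins: "{1..Suc n} = insert (Suc n) {1..n}" by auto
  have upd: "a(Suc n := s) \<in> {1..Suc n} \<rightarrow>\<^sub>E {0, 1}" if "a \<in> {1..n} \<rightarrow>\<^sub>E {0, 1}" "s = 0 \<or> s = 1" for a and s :: real
    unfolding ins by (rule PiE_fun_upd) (use that in auto)
  have del: "a(Suc n := undefined) \<in> {1..n} \<rightarrow>\<^sub>E {0, 1}" if "a \<in> {1..Suc n} \<rightarrow>\<^sub>E {0, 1 :: real}" for a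
    by (rule fun_upd_in_PiE) (use that in \<open>simp_all only: ins, auto\<close>)
  have sum_eq: "(\<Sum>i=1..Suc n. (a i - b i) * \<beta> ^ (Suc n - i)) =
      \<beta> * (\<Sum>i=1..n. (a i - b i) * \<beta> ^ (n - i)) + (a (Suc n) - b (Suc n))" for a b :: "nat \<Rightarrow> real"
    by (simp add: sum_distrib_left Suc_diff_le mult_ac)
  have "bij_betw (\<lambda>((s, t), (a, b)). (a(Suc n := s), b(Suc n := t)))
          (SIGMA (s, t):D. S n ((x - (s - t)) / \<beta>)) (S (Suc n) x)"
  proof (rule bij_betwI[where g = "\<lambda>(a, b). ((a (Suc n), b (Suc n)), (a(Suc n := undefined), b(Suc n := undefined)))"])
    have ext: "(\<Sum>i=1..n. ((a(Suc n := s)) i - (b(Suc n := t)) i) * \<beta> ^ (n - i)) = (\<Sum>i=1..n. (a i - b i) * \<beta> ^ (n - i))"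
      for a b :: "nat \<Rightarrow> real" and s t by (intro sum.cong) auto
    show "(\<lambda>((s, t), (a, b)). (a(Suc n := s), b(Suc n := t))) \<in> (SIGMA (s, t):D. S n ((x - (s - t)) / \<beta>)) \<rightarrow> S (Suc n) x"
    proof safe
      fix s t a b assume D: "(s, t) \<in> D" and ab: "(a, b) \<in> S n ((x - (s - t)) / \<beta>)"
      show "(a(Suc n := s), b(Suc n := t)) \<in> S (Suc n) x"
        unfolding S_def mem_Collect_eq prod.case sum_eq ext
      proof (intro conjI upd)
        have ab': "a \<in> {1..n} \<rightarrow>\<^sub>E {0, 1}" "b \<in> {1..n} \<rightarrow>\<^sub>E {0, 1}"
            "(\<Sum>i=1..n. (a i - b i) * \<beta> ^ (n - i)) = (x - (s - t)) / \<beta>"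
          using ab unfolding S_def mem_Collect_eq prod.case by blast+
        show "a \<in> {1..n} \<rightarrow>\<^sub>E {0, 1}" "b \<in> {1..n} \<rightarrow>\<^sub>E {0, 1}" by fact+
        show "s = 0 \<or> s = 1" "t = 0 \<or> t = 1" using D by (auto simp: D_def)
        show "\<beta> * (\<Sum>i = 1..n. (a i - b i) * \<beta> ^ (n - i)) + ((a(Suc n := s)) (Suc n) - (b(Suc n := t)) (Suc n)) = x"
          unfolding ab'(3) using assms by simp
      qed
    qed
    show "(\<lambda>(a, b). ((a (Suc n), b (Suc n)), (a(Suc n := undefined), b(Suc n := undefined)))) \<in>
        S (Suc n) x \<rightarrow> (SIGMA (s, t):D. S n ((x - (s - t)) / \<beta>))"
    proof (rule funcsetI)
      fix p assume p: "p \<in> S (Suc n) x"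
      obtain a b where ab': "p = (a, b)" by fastforce
      have ab: "(a, b) \<in> S (Suc n) x" using p ab' by simp
      hence A: "a \<in> {1..Suc n} \<rightarrow>\<^sub>E {0, 1}" "b \<in> {1..Suc n} \<rightarrow>\<^sub>E {0, 1}"
        and sm: "\<beta> * (\<Sum>i=1..n. (a i - b i) * \<beta> ^ (n - i)) + (a (Suc n) - b (Suc n)) = x"
        unfolding S_def mem_Collect_eq prod.case sum_eq by auto
      have "a (Suc n) \<in> {0, 1}" "b (Suc n) \<in> {0, 1}" using A by (auto intro: PiE_mem)
      moreover have "(\<Sum>i=1..n. (a i - b i) * \<beta> ^ (n - i)) = (x - (a (Suc n) - b (Suc n))) / \<beta>"
        using sm assms by (auto simp: field_simps)
      hence "(a(Suc n := undefined), b(Suc n := undefined)) \<in> S n ((x - (a (Suc n) - b (Suc n))) / \<beta>)"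
        unfolding S_def mem_Collect_eq prod.case ext
        using A by (simp add: del del: One_nat_def)
      ultimately show "(case p of (a, b) \<Rightarrow> ((a (Suc n), b (Suc n)), (a(Suc n := undefined), b(Suc n := undefined)))) \<in> (SIGMA (s, t):D. S n ((x - (s - t)) / \<beta>))"
        by (auto simp: D_def ab')
    qed
  qed (auto simp: S_def PiE_iff extensional_def fun_eq_iff)
  hence "card (S (Suc n) x) = card (SIGMA (s, t):D. S n ((x - (s - t)) / \<beta>))"
    by (metis bij_betw_same_card)
  also have "\<dots> = (\<Sum>(s, t)\<in>D. card (S n ((x - (s - t)) / \<beta>)))"
    by (subst card_SigmaI) (auto simp: D_def finS case_prod_unfold)
  also have "\<dots> = card (S n ((x - 1) / \<beta>)) + 2 * card (S n (x / \<beta>)) + card (S n ((x + 1) / \<beta>))"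
    by (simp add: D_def sum.cartesian_product[symmetric])
  finally show ?thesis by (simp add: N)
qed

lemma beta_spectrum_iff_num_reps_pos:
  "x \<in> beta_spectrum \<beta> \<longleftrightarrow> (\<exists>n. num_reps \<beta> n x > 0)"
proof -
  have fin: "finite {(a, b). a \<in> {1..n} \<rightarrow>\<^sub>E {0, 1 :: real} \<and> b \<in> {1..n} \<rightarrow>\<^sub>E {0, 1 :: real} \<and>
                   (\<Sum>i=1..n. (a i - b i) * \<beta> ^ (n - i)) = x}" for n
    by (rule finite_subset[of _ "({1..n} \<rightarrow>\<^sub>E {0, 1}) \<times> ({1..n} \<rightarrow>\<^sub>E {0, 1})"])
       (auto intro!: finite_PiE)
  have "(\<exists>c \<in> {1..n} \<rightarrow>\<^sub>E {-1, 0, 1 :: real}. x = (\<Sum>i=1..n. c i * \<beta> ^ (n - i))) \<longleftrightarrow> num_reps \<beta> n x > 0" for n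
  proof
    assume "\<exists>c \<in> {1..n} \<rightarrow>\<^sub>E {-1, 0, 1 :: real}. x = (\<Sum>i=1..n. c i * \<beta> ^ (n - i))"
    then obtain c where c: "c \<in> {1..n} \<rightarrow>\<^sub>E {-1, 0, 1 :: real}" "x = (\<Sum>i=1..n. c i * \<beta> ^ (n - i))" by blast
    define a where "a = restrict (\<lambda>i. max (c i) 0) {1..n}"
    define b where "b = restrict (\<lambda>i. max (- c i) 0) {1..n}"
    have ci: "c i = -1 \<or> c i = 0 \<or> c i = 1" if "i \<in> {1..n}" for i using PiE_mem[OF c(1) that] by auto
    have "a \<in> {1..n} \<rightarrow>\<^sub>E {0, 1 :: real}" "b \<in> {1..n} \<rightarrow>\<^sub>E {0, 1 :: real}"
      using ci unfolding a_def b_def by (intro restrict_PiE_iff[THEN iffD2]; force)+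
    moreover have "(\<Sum>i=1..n. (a i - b i) * \<beta> ^ (n - i)) = x" unfolding c(2)
      by (intro sum.cong) (auto simp: a_def b_def max_def)
    ultimately have "(a, b) \<in> {(a, b). a \<in> {1..n} \<rightarrow>\<^sub>E {0, 1 :: real} \<and> b \<in> {1..n} \<rightarrow>\<^sub>E {0, 1 :: real} \<and>
                   (\<Sum>i=1..n. (a i - b i) * \<beta> ^ (n - i)) = x}" by blast
    thus "num_reps \<beta> n x > 0" unfolding num_reps_def using fin card_gt_0_iff by blast
  next
    assume "num_reps \<beta> n x > 0"
    then obtain a b where ab: "a \<in> {1..n} \<rightarrow>\<^sub>E {0, 1 :: real}" "b \<in> {1..n} \<rightarrow>\<^sub>E {0, 1 :: real}"
        "(\<Sum>i=1..n. (a i - b i) * \<beta> ^ (n - i)) = x"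
      unfolding num_reps_def using fin card_gt_0_iff[of "{(a, b). a \<in> {1..n} \<rightarrow>\<^sub>E {0, 1 :: real} \<and> b \<in> {1..n} \<rightarrow>\<^sub>E {0, 1 :: real} \<and>
                   (\<Sum>i=1..n. (a i - b i) * \<beta> ^ (n - i)) = x}"] by auto
    show "\<exists>c \<in> {1..n} \<rightarrow>\<^sub>E {-1, 0, 1 :: real}. x = (\<Sum>i=1..n. c i * \<beta> ^ (n - i))"
    proof (rule bexI[of _ "restrict (\<lambda>i. a i - b i) {1..n}"])
      show "x = (\<Sum>i=1..n. restrict (\<lambda>i. a i - b i) {1..n} i * \<beta> ^ (n - i))"
        unfolding ab(3)[symmetric] by (intro sum.cong) auto
      have "a i - b i \<in> {-1, 0, 1}" if "i \<in> {1..n}" for i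
        using PiE_mem[OF ab(1) that] PiE_mem[OF ab(2) that] by auto
      thus "restrict (\<lambda>i. a i - b i) {1..n} \<in> {1..n} \<rightarrow>\<^sub>E {-1, 0, 1 :: real}" by simp
    qed
  qed
  thus ?thesis by (simp add: beta_spectrum_def)
qed

section \<open>Existence of the growth rate and of the limiting masses\<close>
definition digit_transfer :: "real \<Rightarrow> (real \<Rightarrow> real) \<Rightarrow> real \<Rightarrow> real" where
  "digit_transfer \<beta> f x = f ((x - 1) / \<beta>) + 2 * f (x / \<beta>) + f ((x + 1) / \<beta>)"

lemma digit_transfer_combine:
  "digit_transfer \<beta> (\<lambda>y. a * f y - b * g y) x = a * digit_transfer \<beta> f x - b * digit_transfer \<beta> g x"
  by (simp add: digit_transfer_def algebra_simps)

text \<open>Intervals \<open>[-R, R]\<close> that contain \<open>I\<close> are closed under the inverse branches, so inequalities on such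
  an interval are preserved by the transfer operator.\<close>
lemma digit_preimage_mem:
  fixes \<beta> :: real
  assumes "\<beta> > 1" "R \<ge> 1 / (\<beta> - 1)" "x \<in> {-R..R}" "\<bar>d\<bar> \<le> 1"
  shows "(x + d) / \<beta> \<in> {-R..R}"
proof -
  have "1 \<le> R * (\<beta> - 1)" using assms by (simp add: pos_divide_le_eq)
  hence "R + 1 \<le> R * \<beta>" by (simp add: algebra_simps)
  moreover have "\<bar>x + d\<bar> \<le> R + 1" using assms by auto
  ultimately have "\<bar>x + d\<bar> \<le> R * \<beta>" by linarith
  hence "\<bar>(x + d) / \<beta>\<bar> \<le> R" using assms by (simp add: pos_divide_le_eq)
  thus ?thesis unfolding abs_le_iff by auto
qed

lemma digit_transfer_nonneg:
  assumes "\<beta> > 1" "R \<ge> 1 / (\<beta> - 1)" "\<And>y. y \<in> {-R..R} \<Longrightarrow> f y \<ge> 0" "x \<in> {-R..R}"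
  shows "digit_transfer \<beta> f x \<ge> 0"
  using digit_preimage_mem[OF assms(1,2,4), of "-1"] digit_preimage_mem[OF assms(1,2,4), of 0]
    digit_preimage_mem[OF assms(1,2,4), of 1]
  unfolding digit_transfer_def
  by (intro add_nonneg_nonneg mult_nonneg_nonneg assms(3)) auto

locale pisot_base =
  fixes \<beta> :: real
  assumes pisot: "pisot \<beta>" and \<beta>_gt_1: "1 < \<beta>" and \<beta>_less_2: "\<beta> < 2"
begin

abbreviation N :: "nat \<Rightarrow> real \<Rightarrow> real" where "N n x \<equiv> real (num_reps \<beta> n x)"

lemma N_Suc: "N (Suc n) x = digit_transfer \<beta> (N n) x"
  using \<beta>_gt_1 by (simp add: num_reps_Suc digit_transfer_def)

lemma N_le_N_0: "N n x \<le> N n 0"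
  using num_reps_le_num_reps_0 by simp

text \<open>A pair may be extended by an equal pair of leading digits, \<open>0, 0\<close> or \<open>1, 1\<close>.\<close>
lemma N_doubling: "2 * N n x \<le> N (Suc n) x"
proof (induction n arbitrary: x)
  case 0
  show ?case by (simp add: N_Suc digit_transfer_def num_reps_0)
next
  case (Suc n)
  have "2 * (a + 2 * b + c) \<le> a' + 2 * b' + c'" if "2 * a \<le> a'" "2 * b \<le> b'" "2 * c \<le> c'" for a b c a' b' c' :: real
    using that by (simp add: algebra_simps)
  from this[OF Suc Suc Suc] have "2 * digit_transfer \<beta> (N n) x \<le> digit_transfer \<beta> (N (Suc n)) x"
    unfolding digit_transfer_def .
  thus ?case by (simp add: N_Suc)
qed

lemma N_mono: "m \<le> n \<Longrightarrow> N m x \<le> N n x"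
proof (induction n rule: dec_induct)
  case (step n)
  thus ?case using N_doubling[of n x] by linarith
qed simp

lemma N_0_pos: "N n 0 \<ge> 1"
  using N_mono[of 0 n 0] by (simp add: num_reps_0)

lemma N_0_Suc_le: "N (Suc n) 0 \<le> 4 * N n 0"
  using N_le_N_0[of n "- 1 / \<beta>"] N_le_N_0[of n "1 / \<beta>"] by (simp add: N_Suc digit_transfer_def)

lemma N_0_add_le: "N (n + k) 0 \<le> 4 ^ k * N n 0"
proof (induction k)
  case (Suc k)
  thus ?case using N_0_Suc_le[of "n + k"] by simp
qed simp

lemma N_outside: "x \<notin> beta_spectrum \<beta> \<Longrightarrow> N n x = 0"
  using beta_spectrum_iff_num_reps_pos[of x \<beta>] by auto

text \<open>Since counts do not decrease with the length, the finitely many points of the spectrum in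
  \<open>[-R, R]\<close> are all reached at one common length.\<close>
lemma uniform_positivity:
  obtains k where "k > 0" "\<And>x. x \<in> beta_spectrum \<beta> \<inter> {-R..R} \<Longrightarrow> N k x \<ge> 1"
proof -
  have "\<forall>x\<in>beta_spectrum \<beta> \<inter> {-R..R}. \<exists>n. N n x \<ge> 1"
    using beta_spectrum_iff_num_reps_pos[of _ \<beta>] by (force simp: Suc_le_eq)
  then obtain f where f: "\<And>x. x \<in> beta_spectrum \<beta> \<inter> {-R..R} \<Longrightarrow> N (f x) x \<ge> 1" by metis
  define k where "k = Suc (\<Sum>x\<in>beta_spectrum \<beta> \<inter> {-R..R}. f x)"
  show ?thesis
  proof (rule that[of k])
    show "k > 0" by (simp add: k_def)
    fix x assume x: "x \<in> beta_spectrum \<beta> \<inter> {-R..R}"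
    have "f x \<le> k" unfolding k_def
      using member_le_sum[OF x, of f] finite_beta_spectrum_bounded[OF pisot] by simp
    thus "N k x \<ge> 1" using f[OF x] N_mono[of "f x" k x] by linarith
  qed
qed

text \<open>A nonnegative start dominates \<open>g 0 0\<close> times the point mass at \<open>0\<close>, and \<open>N\<^sub>k\<close> is the \<open>k\<close>-th iterate
  of that point mass.\<close>
lemma transfer_iterate_lower_bound:
  assumes R: "R \<ge> 1 / (\<beta> - 1)"
    and g: "\<And>i x. g (Suc i) x = digit_transfer \<beta> (g i) x"
    and pos: "\<And>x. x \<in> {-R..R} \<Longrightarrow> g 0 x \<ge> 0" and x: "x \<in> {-R..R}"
  shows "g 0 0 * N k x \<le> g k x"
  using x
proof (induction k arbitrary: x)
  case 0
  thus ?case using pos by (simp add: num_reps_0)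
next
  case (Suc k)
  have "0 \<le> digit_transfer \<beta> (\<lambda>y. 1 * g k y - g 0 0 * N k y) x"
    using Suc by (intro digit_transfer_nonneg[OF \<beta>_gt_1 R]) auto
  thus ?case unfolding digit_transfer_combine by (simp add: g N_Suc)
qed

definition ratio_bounds :: "real \<Rightarrow> nat \<Rightarrow> real \<Rightarrow> real \<Rightarrow> bool" where
  "ratio_bounds R n m M \<longleftrightarrow> (\<forall>x\<in>{-R..R}. m * N n x \<le> N (Suc n) x \<and> N (Suc n) x \<le> M * N n x)"

text \<open>The Doeblin step. Through \<open>N\<^sub>n\<^sub>+\<^sub>1 - m N\<^sub>n \<ge> 0\<close> the surplus \<open>(q - m) N\<^sub>n(0)\<close> at the origin is passed on
  to every point of the spectrum in the interval within \<open>k\<close> steps, and \<open>N\<^sub>n(0) \<ge> 4\<^sup>-\<^sup>k N\<^sub>n\<^sub>+\<^sub>k(x)\<close> for all \<open>x\<close>. The same holds for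
  the deficit with respect to \<open>M\<close>; together the gap \<open>M - m\<close> shrinks by the factor \<open>1 - \<theta>\<close>.\<close>
lemma ratio_bounds_contract:
  assumes R: "R \<ge> 1 / (\<beta> - 1)" and b: "ratio_bounds R n m M"
    and k: "\<And>x. x \<in> beta_spectrum \<beta> \<inter> {-R..R} \<Longrightarrow> N k x \<ge> 1"
  defines "q \<equiv> N (Suc n) 0 / N n 0" and "\<theta> \<equiv> 1 / 4 ^ k"
  shows "ratio_bounds R (n + k) (m + \<theta> * (q - m)) (M - \<theta> * (M - q))"
  unfolding ratio_bounds_def
proof
  fix x assume x: "x \<in> {-R..R}"
  have R0: "0 \<in> {-R..R}" using R \<beta>_gt_1 by (auto intro: order_trans[of 0 "1 / (\<beta> - 1)"])
  have n0: "N n 0 > 0" using N_0_pos[of n] by linarith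
  have N1: "N (Suc n) 0 = q * N n 0" using n0 by (simp add: q_def)
  have "m * N n 0 \<le> q * N n 0" "q * N n 0 \<le> M * N n 0"
    using b R0 by (simp_all add: ratio_bounds_def N1[symmetric])
  hence q: "q - m \<ge> 0" "M - q \<ge> 0" using n0 by auto
  have doeblin: "\<theta> * N (n + k) x \<le> N n 0 * N k x"
  proof (cases "x \<in> beta_spectrum \<beta>")
    case True
    have "N (n + k) x \<le> 4 ^ k * N n 0" using N_le_N_0[of "n + k" x] N_0_add_le[of n k] by linarith
    hence "\<theta> * N (n + k) x \<le> N n 0" by (simp add: \<theta>_def field_simps)
    also have "\<dots> \<le> N n 0 * N k x" using k[of x] x True n0 by simp
    finally show ?thesis .
  qed (simp add: N_outside)
  have "(N (Suc n) 0 - m * N n 0) * N k x \<le> N (Suc (n + k)) x - m * N (n + k) x"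
    using transfer_iterate_lower_bound[OF R, of "\<lambda>i x. 1 * N (Suc (n + i)) x - m * N (n + i) x" x k]
      b x unfolding ratio_bounds_def digit_transfer_combine by (simp add: N_Suc[symmetric])
  hence "(q - m) * (N n 0 * N k x) \<le> N (Suc (n + k)) x - m * N (n + k) x"
    by (simp add: N1 algebra_simps)
  moreover have "(M * N n 0 - N (Suc n) 0) * N k x \<le> M * N (n + k) x - N (Suc (n + k)) x"
    using transfer_iterate_lower_bound[OF R, of "\<lambda>i x. M * N (n + i) x - 1 * N (Suc (n + i)) x" x k]
      b x unfolding ratio_bounds_def digit_transfer_combine by (simp add: N_Suc[symmetric])
  hence "(M - q) * (N n 0 * N k x) \<le> M * N (n + k) x - N (Suc (n + k)) x"
    by (simp add: N1 algebra_simps)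
  ultimately show "(m + \<theta> * (q - m)) * N (n + k) x \<le> N (Suc (n + k)) x \<and>
      N (Suc (n + k)) x \<le> (M - \<theta> * (M - q)) * N (n + k) x"
    using mult_left_mono[OF doeblin q(1)] mult_left_mono[OF doeblin q(2)] by (auto simp: algebra_simps)
qed

lemma ratio_bounds_add:
  assumes R: "R \<ge> 1 / (\<beta> - 1)" and b: "ratio_bounds R n m M"
  shows "ratio_bounds R (n + k) m M"
proof (induction k)
  case (Suc k)
  have "0 \<le> digit_transfer \<beta> (\<lambda>y. 1 * N (Suc (n + k)) y - m * N (n + k) y) x"
       "0 \<le> digit_transfer \<beta> (\<lambda>y. M * N (n + k) y - 1 * N (Suc (n + k)) y) x" if "x \<in> {-R..R}" for x
    using Suc that by (intro digit_transfer_nonneg[OF \<beta>_gt_1 R]; force simp: ratio_bounds_def)+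
  thus ?case unfolding digit_transfer_combine by (simp add: ratio_bounds_def N_Suc)
qed (use b in simp)

lemma ratio_bounds_ratio:
  assumes R: "R \<ge> 1 / (\<beta> - 1)" and b: "ratio_bounds R n m M" and "i \<ge> n" "x \<in> {-R..R}" "N i x > 0"
  shows "N (Suc i) x / N i x \<in> {m..M}"
  using ratio_bounds_add[OF R b, of "i - n"] assms by (auto simp: ratio_bounds_def field_simps)

lemma ratio_bounds_geometric:
  assumes R: "R \<ge> 1 / (\<beta> - 1)"
  obtains C \<rho> n0 where "0 < \<rho>" "\<rho> < 1" "C \<ge> 0"
    "\<And>x. x \<in> beta_spectrum \<beta> \<inter> {-R..R} \<Longrightarrow> N n0 x \<ge> 1"
    "\<And>n. n \<ge> n0 \<Longrightarrow> \<exists>m M. ratio_bounds R n m M \<and> M - m \<le> C * \<rho> ^ n"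
proof -
  obtain k where k: "k > 0" "\<And>x. x \<in> beta_spectrum \<beta> \<inter> {-R..R} \<Longrightarrow> N k x \<ge> 1"
    by (rule uniform_positivity) blast
  define \<theta> :: real where "\<theta> = 1 / 4 ^ k"
  have \<theta>: "0 < \<theta>" "\<theta> < 1" using k by (simp_all add: \<theta>_def one_less_power)
  \<comment> \<open>A contraction by \<open>1 - \<theta>\<close> every \<open>k\<close> steps is a contraction by its \<open>k\<close>-th root per step.\<close>
  define \<rho> where "\<rho> = root k (1 - \<theta>)"
  have \<rho>: "0 < \<rho>" "\<rho> < 1" "\<rho> ^ k = 1 - \<theta>" using \<theta> k by (auto simp: \<rho>_def)
  \<comment> \<open>Large enough for the trivial bounds \<open>0\<close> and \<open>N (Suc (2 * k)) 0\<close> at the starting lengths \<open>k \<le> n < 2k\<close>.\<close>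
  define C where "C = N (Suc (2 * k)) 0 / \<rho> ^ (2 * k)"
  have C: "C \<ge> 0" using \<rho> by (simp add: C_def)
  have "\<exists>m M. ratio_bounds R n m M \<and> M - m \<le> C * \<rho> ^ n" if "n \<ge> k" for n
    using that
  proof (induction n rule: less_induct)
    case (less n)
    show ?case
    proof (cases "n < 2 * k")
      case True
      have "ratio_bounds R n 0 (N (Suc (2 * k)) 0)" unfolding ratio_bounds_def
      proof
        fix x assume x: "x \<in> {-R..R}"
        have "N (Suc n) x \<le> N (Suc (2 * k)) 0 * N n x"
        proof (cases "x \<in> beta_spectrum \<beta>")
          case xX: True
          have "1 \<le> N n x" using k(2)[of x] N_mono[OF less.prems, of x] x xX by force
          moreover have "N (Suc n) x \<le> N (Suc (2 * k)) 0"
            using N_le_N_0[of "Suc n" x] N_mono[of "Suc n" "Suc (2 * k)" 0] True by linarith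
          ultimately show ?thesis using mult_left_mono[of 1 "N n x" "N (Suc (2 * k)) 0"] by simp
        qed (simp add: N_outside)
        thus "0 * N n x \<le> N (Suc n) x \<and> N (Suc n) x \<le> N (Suc (2 * k)) 0 * N n x" by simp
      qed
      moreover have "N (Suc (2 * k)) 0 - 0 \<le> C * \<rho> ^ n"
      proof -
        have "\<rho> ^ (2 * k) \<le> \<rho> ^ n" using \<rho> True by (intro power_decreasing) auto
        hence "C * \<rho> ^ (2 * k) \<le> C * \<rho> ^ n" using C by (intro mult_left_mono) auto
        thus ?thesis using \<rho> by (simp add: C_def)
      qed
      ultimately show ?thesis by blast
    next
      case False
      hence "n - k < n" "n - k \<ge> k" using k by auto
      then obtain m M where mM: "ratio_bounds R (n - k) m M" "M - m \<le> C * \<rho> ^ (n - k)"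
        using less.IH by blast
      define q where "q = N (Suc (n - k)) 0 / N (n - k) 0"
      have "ratio_bounds R n (m + \<theta> * (q - m)) (M - \<theta> * (M - q))"
        using ratio_bounds_contract[OF R mM(1) k(2)] False by (simp add: q_def \<theta>_def)
      moreover have "(M - \<theta> * (M - q)) - (m + \<theta> * (q - m)) \<le> C * \<rho> ^ n"
      proof -
        have "(M - \<theta> * (M - q)) - (m + \<theta> * (q - m)) = (1 - \<theta>) * (M - m)" by (simp add: algebra_simps)
        also have "\<dots> \<le> (1 - \<theta>) * (C * \<rho> ^ (n - k))" using mM(2) \<theta> by (intro mult_left_mono) auto
        also have "\<dots> = C * (\<rho> ^ k * \<rho> ^ (n - k))" by (simp add: \<rho>(3))
        also have "\<dots> = C * \<rho> ^ n" using False by (simp add: power_add[symmetric])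
        finally show ?thesis .
      qed
      ultimately show ?thesis by blast
    qed
  qed
  thus ?thesis using that[OF \<rho>(1,2) C k(2)] by blast
qed

text \<open>Geometric convergence of the ratios \<open>N\<^sub>n\<^sub>+\<^sub>1(x) / N\<^sub>n(x)\<close> to one limit \<open>l\<close> makes the infinite product of
  the \<open>N\<^sub>n\<^sub>+\<^sub>1(x) / (l N\<^sub>n(x))\<close> converge to a positive number.\<close>
lemma scaled_limit_on_bounded:
  assumes R: "R \<ge> 1 / (\<beta> - 1)"
  shows "\<exists>l\<ge>2. (\<lambda>n. N (Suc n) 0 / N n 0) \<longlonglongrightarrow> l \<and>
     (\<forall>x\<in>beta_spectrum \<beta> \<inter> {-R..R}. \<exists>m>0. (\<lambda>n. N n x / l ^ n) \<longlonglongrightarrow> m)"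
proof -
  obtain C \<rho> n0 where \<rho>: "0 < \<rho>" "\<rho> < 1" and C: "C \<ge> 0"
    and n0: "\<And>x. x \<in> beta_spectrum \<beta> \<inter> {-R..R} \<Longrightarrow> N n0 x \<ge> 1"
    and mM: "\<And>n. n \<ge> n0 \<Longrightarrow> \<exists>m M. ratio_bounds R n m M \<and> M - m \<le> C * \<rho> ^ n"
    by (rule ratio_bounds_geometric[OF R]) blast
  define q where "q = (\<lambda>n. N (Suc n) 0 / N n 0)"
  have R0: "0 \<in> {-R..R}" using R \<beta>_gt_1 by (auto intro: order_trans[of 0 "1 / (\<beta> - 1)"])
  have pos0: "N n 0 > 0" for n using N_0_pos[of n] by linarith
  have dist_q: "\<bar>N (Suc n) x / N n x - q i\<bar> \<le> C * \<rho> ^ n"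
    if "n \<ge> n0" "i \<ge> n" "x \<in> {-R..R}" "N n x > 0" for n i x
  proof -
    obtain m M where b: "ratio_bounds R n m M" "M - m \<le> C * \<rho> ^ n" using mM[OF \<open>n0 \<le> n\<close>] by blast
    have "N (Suc n) x / N n x \<in> {m..M}" using that by (intro ratio_bounds_ratio[OF R b(1)]) auto
    moreover have "q i \<in> {m..M}" unfolding q_def
      using that R0 pos0 by (intro ratio_bounds_ratio[OF R b(1)]) auto
    ultimately show ?thesis using b(2) by auto
  qed
  have geo: "(\<lambda>n. C * \<rho> ^ n) \<longlonglongrightarrow> 0"
    using \<rho> by (intro tendsto_mult_right_zero LIMSEQ_realpow_zero) auto
  have "Cauchy q"
  proof (rule CauchyI')
    fix e :: real assume "e > 0"
    hence "eventually (\<lambda>n. C * \<rho> ^ n < e) sequentially" using geo by (rule order_tendstoD(2)[rotated])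
    then obtain n1 where n1: "\<And>n. n \<ge> n1 \<Longrightarrow> C * \<rho> ^ n < e" by (auto simp: eventually_sequentially)
    show "\<exists>M. \<forall>m\<ge>M. \<forall>n>m. dist (q m) (q n) < e"
    proof (intro exI[of _ "max n0 n1"] allI impI)
      fix m n assume "m \<ge> max n0 n1" "n > m"
      thus "dist (q m) (q n) < e" 
        using dist_q[of m n 0] R0 pos0 n1[of m] by (simp add: dist_real_def q_def)
    qed
  qed
  then obtain l where l: "q \<longlonglongrightarrow> l" using Cauchy_convergent convergent_def by blast
  have "q n \<ge> 2" for n using N_doubling[of n 0] pos0[of n] by (simp add: q_def field_simps)
  hence l2: "l \<ge> 2" using LIMSEQ_le_const[OF l] by blast
  have dist_l: "\<bar>N (Suc n) x / N n x - l\<bar> \<le> C * \<rho> ^ n"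
    if "n \<ge> n0" "x \<in> {-R..R}" "N n x > 0" for n x
  proof (rule LIMSEQ_le_const2)
    show "(\<lambda>i. \<bar>N (Suc n) x / N n x - q i\<bar>) \<longlonglongrightarrow> \<bar>N (Suc n) x / N n x - l\<bar>"
      using l by (intro tendsto_intros)
    show "\<exists>j. \<forall>i\<ge>j. \<bar>N (Suc n) x / N n x - q i\<bar> \<le> C * \<rho> ^ n" using dist_q that by blast
  qed
  have "\<exists>m>0. (\<lambda>n. N n x / l ^ n) \<longlonglongrightarrow> m" if x: "x \<in> beta_spectrum \<beta> \<inter> {-R..R}" for x
  proof -
    have pos: "N n x > 0" if "n \<ge> n0" for n using n0[OF x] N_mono[OF that, of x] by linarith
    define f where "f = (\<lambda>i. N (Suc (n0 + i)) x / (N (n0 + i) x * l))"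
    have f_pos: "f i > 0" for i using pos[of "n0 + i"] pos[of "Suc (n0 + i)"] l2 by (simp add: f_def)
    have f_dist: "\<bar>f i - 1\<bar> \<le> C * \<rho> ^ i" for i
    proof -
      have "f i - 1 = (N (Suc (n0 + i)) x / N (n0 + i) x - l) / l"
        using l2 pos[of "n0 + i"] by (simp add: f_def field_simps)
      hence "\<bar>f i - 1\<bar> = \<bar>N (Suc (n0 + i)) x / N (n0 + i) x - l\<bar> / l" using l2 by simp
      also have "\<dots> \<le> \<bar>N (Suc (n0 + i)) x / N (n0 + i) x - l\<bar> / 1" using l2 by (intro divide_left_mono) auto
      also have "\<dots> \<le> C * \<rho> ^ (n0 + i)" using dist_l[of "n0 + i" x] x pos[of "n0 + i"] by simp
      also have "\<dots> \<le> C * \<rho> ^ i" using C \<rho> by (intro mult_left_mono power_decreasing) auto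
      finally show ?thesis .
    qed
    have "summable (\<lambda>i. norm (f i - 1))"
      by (rule summable_comparison_test'[of "\<lambda>i. C * \<rho> ^ i" 0])
         (use f_dist \<rho> in \<open>auto intro!: summable_mult summable_geometric\<close>)
    hence "convergent_prod f"
      by (intro abs_convergent_prod_imp_convergent_prod) (simp add: abs_convergent_prod_conv_summable)
    then obtain L where L: "L \<noteq> 0" "(\<lambda>n. \<Prod>i\<le>n. f i) \<longlonglongrightarrow> L"
      using f_pos by (subst (asm) convergent_prod_iff_nz_lim) (metis less_irrefl, blast)
    have "L \<ge> 0" using L(2) f_pos by (intro LIMSEQ_le_const[OF L(2)]) (auto intro!: exI[of _ 0] prod_nonneg intro: less_imp_le)
    hence "L > 0" using L(1) by simp
    have prod_f: "(\<Prod>i\<le>n. f i) = N (n + Suc n0) x / (N n0 x * l ^ Suc n)" for n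
    proof (induction n)
      case 0
      show ?case by (simp add: f_def)
    next
      case (Suc n)
      thus ?case using l2 pos[of "Suc (n0 + n)"] by (simp add: f_def add_ac)
    qed
    have "(\<lambda>n. N (n + Suc n0) x / l ^ (n + Suc n0)) \<longlonglongrightarrow> L * (N n0 x / l ^ n0)"
    proof (rule Lim_transform_eventually)
      show "(\<lambda>n. (\<Prod>i\<le>n. f i) * (N n0 x / l ^ n0)) \<longlonglongrightarrow> L * (N n0 x / l ^ n0)"
        by (intro tendsto_mult L tendsto_const)
      show "\<forall>\<^sub>F n in sequentially. (\<Prod>i\<le>n. f i) * (N n0 x / l ^ n0) = N (n + Suc n0) x / l ^ (n + Suc n0)"
        using l2 pos[of n0] by (intro always_eventually allI) (simp add: prod_f power_add field_simps)
    qed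
    hence "(\<lambda>n. N n x / l ^ n) \<longlonglongrightarrow> L * (N n0 x / l ^ n0)" by (rule LIMSEQ_offset)
    moreover have "L * (N n0 x / l ^ n0) > 0" using \<open>L > 0\<close> l2 pos[of n0] by simp
    ultimately show ?thesis by blast
  qed
  thus ?thesis using l l2 unfolding q_def by blast
qed

lemma zero_in_beta_spectrum: "0 \<in> beta_spectrum \<beta>"
  using beta_spectrum_iff_num_reps_pos[of 0 \<beta>] num_reps_0[of \<beta> 0] by (metis zero_less_one)

text \<open>The limit of the ratios at \<open>0\<close> does not depend on the interval, so a single \<open>l\<close> serves all points;
  it is unique because the behaviour at \<open>0\<close> determines it.\<close>
lemma growth_rate_props:
  shows "growth_rate \<beta> \<ge> 2"
    and "x \<in> beta_spectrum \<beta> \<Longrightarrow> \<exists>m>0. (\<lambda>n. N n x / growth_rate \<beta> ^ n) \<longlonglongrightarrow> m"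
proof -
  define R0 where "R0 = 1 / (\<beta> - 1)"
  obtain l where l: "l \<ge> 2" "(\<lambda>n. N (Suc n) 0 / N n 0) \<longlonglongrightarrow> l"
    using scaled_limit_on_bounded[of R0] by (auto simp: R0_def)
  have lim: "\<exists>m>0. (\<lambda>n. N n x / l ^ n) \<longlonglongrightarrow> m" if x: "x \<in> beta_spectrum \<beta>" for x
  proof -
    define R where "R = max R0 \<bar>x\<bar>"
    obtain l' where "(\<lambda>n. N (Suc n) 0 / N n 0) \<longlonglongrightarrow> l'"
      "\<forall>x\<in>beta_spectrum \<beta> \<inter> {-R..R}. \<exists>m>0. (\<lambda>n. N n x / l' ^ n) \<longlonglongrightarrow> m"
      using scaled_limit_on_bounded[of R] by (auto simp: R_def R0_def)
    moreover from this(1) l(2) have "l' = l" by (rule LIMSEQ_unique)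
    moreover have "x \<in> {-R..R}" by (auto simp: R_def)
    ultimately show ?thesis using x by blast
  qed
  have "growth_rate \<beta> = l" unfolding growth_rate_def
  proof (rule the_equality)
    show "l > 1 \<and> (\<forall>x\<in>beta_spectrum \<beta>. \<exists>m>0. (\<lambda>n. N n x / l ^ n) \<longlonglongrightarrow> m)"
      using l(1) lim by auto
  next
    fix l' assume l': "l' > 1 \<and> (\<forall>x\<in>beta_spectrum \<beta>. \<exists>m>0. (\<lambda>n. N n x / l' ^ n) \<longlonglongrightarrow> m)"
    then obtain m where m: "m > 0" "(\<lambda>n. N n 0 / l' ^ n) \<longlonglongrightarrow> m"
      using zero_in_beta_spectrum by blast
    have "(\<lambda>n. l' * ((N (Suc n) 0 / l' ^ Suc n) / (N n 0 / l' ^ n))) \<longlonglongrightarrow> l' * (m / m)"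
      using m by (intro tendsto_intros LIMSEQ_Suc) auto
    moreover have "l' * ((N (Suc n) 0 / l' ^ Suc n) / (N n 0 / l' ^ n)) = N (Suc n) 0 / N n 0" for n
      using l' by simp
    ultimately have "(\<lambda>n. N (Suc n) 0 / N n 0) \<longlonglongrightarrow> l'" using m by (simp only:) simp
    thus "l' = l" using l(2) by (rule LIMSEQ_unique)
  qed
  thus "growth_rate \<beta> \<ge> 2" "x \<in> beta_spectrum \<beta> \<Longrightarrow> \<exists>m>0. (\<lambda>n. N n x / growth_rate \<beta> ^ n) \<longlonglongrightarrow> m"
    using l lim by auto
qed

lemma spectrum_mass_limit: "(\<lambda>n. N n x / growth_rate \<beta> ^ n) \<longlonglongrightarrow> spectrum_mass \<beta> x"
proof (cases "x \<in> beta_spectrum \<beta>")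
  case True
  thus ?thesis using growth_rate_props(2)[OF True] unfolding spectrum_mass_def
    by (metis limI)
next
  case False
  thus ?thesis unfolding spectrum_mass_def by (simp add: N_outside)
qed

lemma spectrum_mass_pos: "x \<in> beta_spectrum \<beta> \<Longrightarrow> spectrum_mass \<beta> x > 0"
  using growth_rate_props(2)[of x] spectrum_mass_limit[of x] LIMSEQ_unique by blast

lemma spectrum_mass_outside: "x \<notin> beta_spectrum \<beta> \<Longrightarrow> spectrum_mass \<beta> x = 0"
  using spectrum_mass_limit[of x] by (simp add: N_outside LIMSEQ_const_iff)

lemma spectrum_mass_nonneg: "spectrum_mass \<beta> x \<ge> 0"
  using spectrum_mass_pos spectrum_mass_outside by (metis less_imp_le order_refl)

lemma spectrum_mass_eigen: "growth_rate \<beta> * spectrum_mass \<beta> x = digit_transfer \<beta> (spectrum_mass \<beta>) x"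
proof -
  define l where "l = growth_rate \<beta>"
  have l: "l > 0" using growth_rate_props(1) by (simp add: l_def)
  have "(\<lambda>n. digit_transfer \<beta> (\<lambda>y. N n y / l ^ n) x) \<longlonglongrightarrow> digit_transfer \<beta> (spectrum_mass \<beta>) x"
    unfolding digit_transfer_def l_def by (intro tendsto_intros spectrum_mass_limit)
  moreover have "(\<lambda>n. l * (N (Suc n) x / l ^ Suc n)) \<longlonglongrightarrow> l * spectrum_mass \<beta> x"
    unfolding l_def by (intro tendsto_intros LIMSEQ_Suc spectrum_mass_limit)
  moreover have "l * (N (Suc n) x / l ^ Suc n) = digit_transfer \<beta> (\<lambda>y. N n y / l ^ n) x" for n
    using l by (simp add: N_Suc digit_transfer_def field_simps)
  ultimately show ?thesis unfolding l_def by (simp add: LIMSEQ_unique)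
qed

lemma N_0_growth_bound:
  obtains C where "C > 0" "\<And>n. N n 0 \<le> C * growth_rate \<beta> ^ n"
proof -
  have "Bseq (\<lambda>n. N n 0 / growth_rate \<beta> ^ n)"
    using spectrum_mass_limit by (rule convergent_imp_Bseq[OF convergentI])
  then obtain C where C: "C > 0" "\<And>n. \<bar>N n 0 / growth_rate \<beta> ^ n\<bar> \<le> C"
    by (auto elim: BseqE)
  show ?thesis
  proof (rule that[OF C(1)])
    fix n
    show "N n 0 \<le> C * growth_rate \<beta> ^ n"
      using C(2)[of n] growth_rate_props(1) by (simp add: field_simps)
  qed
qed

end

section \<open>Wasserstein distance to Lebesgue measure controls the growth rate\<close>
lemma emeasure_spectrum_measure:
  assumes "B \<in> sets borel" "finite (beta_spectrum \<beta> \<inter> B)"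
  shows "emeasure (spectrum_measure \<beta>) B = (\<Sum>x\<in>beta_spectrum \<beta> \<inter> B. ennreal (spectrum_mass \<beta> x))"
proof -
  have "(\<lambda>x. x) \<in> point_measure (beta_spectrum \<beta>) (\<lambda>x. ennreal (spectrum_mass \<beta> x)) \<rightarrow>\<^sub>M borel"
    by simp
  hence "emeasure (spectrum_measure \<beta>) B =
      emeasure (point_measure (beta_spectrum \<beta>) (\<lambda>x. ennreal (spectrum_mass \<beta> x))) (beta_spectrum \<beta> \<inter> B)"
    unfolding spectrum_measure_def using assms(1)
    by (subst emeasure_distr) (auto simp: space_point_measure Int_commute)
  thus ?thesis using assms(2) by (simp add: emeasure_point_measure_finite2)
qed

text \<open>If the first coordinate lies in \<open>[a, b]\<close> then either the second lies in the \<open>\<delta>\<close>-neighbourhood or the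
  two are at least \<open>\<delta>\<close> apart; Markov's inequality bounds the second event.\<close>
lemma coupling_interval_le:
  assumes P: "P \<in> couplings M L" and \<delta>: "\<delta> > 0"
  shows "emeasure M {a..b} \<le> emeasure L {a - \<delta>..b + \<delta>} + (\<integral>\<^sup>+ (x, y). ennreal (dist x y) \<partial>P) / ennreal \<delta>"
proof -
  have sets: "sets P = sets (borel \<Otimes>\<^sub>M borel)" and M: "M = distr P borel fst" and L: "L = distr P borel snd"
    using P by (auto simp: couplings_def)
  have space: "space P = UNIV" using sets_eq_imp_space_eq[OF sets] by (simp add: space_pair_measure)
  have [measurable]: "fst \<in> P \<rightarrow>\<^sub>M borel" "snd \<in> P \<rightarrow>\<^sub>M borel"
    by (simp_all add: measurable_cong_sets[OF sets refl])
  have dist_meas: "(\<lambda>(x::real, y). ennreal (dist x y)) \<in> borel_measurable P"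
    by (simp add: case_prod_unfold) measurable
  define D where "D = {p \<in> space P. 1 \<le> ennreal (1 / \<delta>) * (case p of (x::real, y) \<Rightarrow> ennreal (dist x y))}"
  have [measurable]: "D \<in> sets P" unfolding D_def using dist_meas by measurable
  have "emeasure M {a..b} = emeasure P (fst -` {a..b} \<inter> space P)"
    unfolding M by (rule emeasure_distr) auto
  also have "\<dots> \<le> emeasure P ((snd -` {a - \<delta>..b + \<delta>} \<inter> space P) \<union> D)"
  proof (rule emeasure_mono)
    show "fst -` {a..b} \<inter> space P \<subseteq> (snd -` {a - \<delta>..b + \<delta>} \<inter> space P) \<union> D"
    proof
      fix p assume p: "p \<in> fst -` {a..b} \<inter> space P"
      obtain x y where xy: "p = (x, y)" by fastforce
      show "p \<in> (snd -` {a - \<delta>..b + \<delta>} \<inter> space P) \<union> D"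
      proof (cases "dist x y \<ge> \<delta>")
        case True
        hence "1 \<le> ennreal (1 / \<delta> * dist x y)" using \<delta> by (simp add: field_simps flip: ennreal_1)
        thus ?thesis using \<delta> by (simp add: D_def xy space flip: ennreal_mult)
      next
        case False
        thus ?thesis using p by (auto simp: xy dist_real_def space)
      qed
    qed
    show "(snd -` {a - \<delta>..b + \<delta>} \<inter> space P) \<union> D \<in> sets P" by measurable
  qed
  also have "\<dots> \<le> emeasure P (snd -` {a - \<delta>..b + \<delta>} \<inter> space P) + emeasure P D"
    by (rule emeasure_subadditive) measurable
  also have "emeasure P (snd -` {a - \<delta>..b + \<delta>} \<inter> space P) = emeasure L {a - \<delta>..b + \<delta>}"
    unfolding L by (rule emeasure_distr[symmetric]) auto
  also have "emeasure P D \<le> ennreal (1 / \<delta>) * (\<integral>\<^sup>+ p. (case p of (x, y) \<Rightarrow> ennreal (dist x y)) \<partial>P)"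
    using nn_integral_Markov_inequality[of "\<lambda>(x::real, y). ennreal (dist x y)" "space P" P "ennreal (1 / \<delta>)"] dist_meas
      sets.top[of P] by (simp add: D_def space)
  also have "\<dots> = (\<integral>\<^sup>+ (x, y). ennreal (dist x y) \<partial>P) / ennreal \<delta>"
    using \<delta> by (simp add: divide_ennreal_def inverse_ennreal inverse_eq_divide mult.commute)
  finally show ?thesis by (simp add: add_left_mono)
qed

lemma ennreal_digit_sum:
  assumes "x \<ge> 0" "y \<ge> 0" "z \<ge> 0"
  shows "ennreal (x + 2 * y + z) = ennreal x + 2 * ennreal y + ennreal z"
  using assms by (simp add: ennreal_plus ennreal_mult)

context pisot_base
begin

definition half_length :: real where "half_length = 1 / (\<beta> - 1)"

lemma half_length_gt_1: "half_length > 1" using \<beta>_gt_1 \<beta>_less_2 by (simp add: half_length_def)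

lemma I_interval_eq: "I_interval \<beta> = {-half_length..half_length}" by (simp add: I_interval_def half_length_def)

definition total_mass :: real where "total_mass = (\<Sum>x\<in>beta_spectrum \<beta> \<inter> I_interval \<beta>. spectrum_mass \<beta> x)"

lemma finite_spectrum_in_I: "finite (beta_spectrum \<beta> \<inter> I_interval \<beta>)"
  unfolding I_interval_eq by (rule finite_beta_spectrum_bounded[OF pisot])

lemma total_mass_pos: "total_mass > 0"
  unfolding total_mass_def using finite_spectrum_in_I zero_in_beta_spectrum half_length_gt_1
  by (intro sum_pos2[of _ 0]) (auto simp: I_interval_eq spectrum_mass_pos spectrum_mass_nonneg)

lemma emeasure_spectrum_prob:
  assumes "B \<in> sets borel"
  shows "emeasure (spectrum_prob \<beta>) B = ennreal ((\<Sum>x\<in>beta_spectrum \<beta> \<inter> (I_interval \<beta> \<inter> B). spectrum_mass \<beta> x) / total_mass)"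
proof -
  have I: "I_interval \<beta> \<in> sets borel" by (simp add: I_interval_eq)
  have fin: "finite (beta_spectrum \<beta> \<inter> (I_interval \<beta> \<inter> B))"
    by (rule finite_subset[OF _ finite_spectrum_in_I]) auto
  have "emeasure (spectrum_prob \<beta>) B = emeasure (spectrum_measure \<beta>) (I_interval \<beta> \<inter> B) / emeasure (spectrum_measure \<beta>) (I_interval \<beta>)"
    unfolding spectrum_prob_def using assms I by (intro emeasure_uniform_measure) (auto simp: spectrum_measure_def)
  also have "\<dots> = ennreal (\<Sum>x\<in>beta_spectrum \<beta> \<inter> (I_interval \<beta> \<inter> B). spectrum_mass \<beta> x) / ennreal total_mass"
    using assms I fin finite_spectrum_in_I
    by (simp add: emeasure_spectrum_measure spectrum_mass_nonneg sum_ennreal total_mass_def)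
  also have "\<dots> = ennreal ((\<Sum>x\<in>beta_spectrum \<beta> \<inter> (I_interval \<beta> \<inter> B). spectrum_mass \<beta> x) / total_mass)"
    using total_mass_pos by (intro divide_ennreal) (auto intro: sum_nonneg spectrum_mass_nonneg)
  finally show ?thesis .
qed

lemma lebesgue_prob_interval_le:
  assumes "a \<le> b"
  shows "emeasure (lebesgue_prob \<beta>) {a..b} \<le> ennreal ((b - a) / (2 * half_length))"
proof -
  have "emeasure (lebesgue_prob \<beta>) {a..b} = emeasure lborel (I_interval \<beta> \<inter> {a..b}) / emeasure lborel (I_interval \<beta>)"
    unfolding lebesgue_prob_def by (intro emeasure_uniform_measure) (auto simp: I_interval_eq)
  also have "\<dots> \<le> emeasure lborel {a..b} / emeasure lborel (I_interval \<beta>)"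
    by (intro divide_right_mono_ennreal emeasure_mono) auto
  also have "\<dots> = ennreal (b - a) / ennreal (2 * half_length)" using assms half_length_gt_1 by (simp add: I_interval_eq)
  also have "\<dots> = ennreal ((b - a) / (2 * half_length))" using assms half_length_gt_1 by (intro divide_ennreal) auto
  finally show ?thesis .
qed

text \<open>The preimage of \<open>I\<close> under \<open>y \<mapsto> \<beta>y + d\<close>.\<close>
definition branch_interval :: "real \<Rightarrow> real set" where "branch_interval d = {(-half_length - d) / \<beta>..(half_length - d) / \<beta>}"

text \<open>Substitute \<open>y = (x - d) / \<beta>\<close>. Only points \<open>y\<close> of the spectrum contribute, and for those
  \<open>\<beta>y + d\<close> is again in the spectrum.\<close>
lemma sum_mass_preimage:
  assumes d: "d \<in> {-1, 0, 1}"
  shows "(\<Sum>x\<in>beta_spectrum \<beta> \<inter> I_interval \<beta>. spectrum_mass \<beta> ((x - d) / \<beta>)) =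
         (\<Sum>y\<in>beta_spectrum \<beta> \<inter> (I_interval \<beta> \<inter> branch_interval d). spectrum_mass \<beta> y)"
proof -
  let ?h = "\<lambda>x. (x - d) / \<beta>"
  have mem: "y \<in> branch_interval d \<longleftrightarrow> \<beta> * y + d \<in> I_interval \<beta>" for y
    using \<beta>_gt_1 by (auto simp: branch_interval_def I_interval_eq field_simps)
  have sub: "branch_interval d \<subseteq> I_interval \<beta>"
  proof
    fix y assume "y \<in> branch_interval d"
    hence "\<beta> * y + d \<in> {-half_length..half_length}" by (simp add: mem I_interval_eq)
    hence "((\<beta> * y + d) + (- d)) / \<beta> \<in> {-half_length..half_length}"
      using \<beta>_gt_1 d by (intro digit_preimage_mem) (auto simp: half_length_def)
    thus "y \<in> I_interval \<beta>" using \<beta>_gt_1 by (simp add: I_interval_eq)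
  qed
  have closed: "\<beta> * y + d \<in> beta_spectrum \<beta>" if y: "y \<in> beta_spectrum \<beta>" for y
  proof -
    obtain n where "N n y > 0" using y beta_spectrum_iff_num_reps_pos[of y \<beta>] by auto
    hence "N (Suc n) (\<beta> * y + d) > 0"
      using d \<beta>_gt_1 by (auto simp: N_Suc digit_transfer_def intro: add_pos_nonneg add_nonneg_pos)
    thus ?thesis using beta_spectrum_iff_num_reps_pos[of "\<beta> * y + d" \<beta>] by auto
  qed
  have fin: "finite (beta_spectrum \<beta> \<inter> (I_interval \<beta> \<inter> branch_interval d))"
    by (rule finite_subset[OF _ finite_spectrum_in_I]) auto
  have "(\<Sum>x\<in>beta_spectrum \<beta> \<inter> I_interval \<beta>. spectrum_mass \<beta> (?h x)) =
        (\<Sum>x\<in>(\<lambda>y. \<beta> * y + d) ` (beta_spectrum \<beta> \<inter> (I_interval \<beta> \<inter> branch_interval d)). spectrum_mass \<beta> (?h x))"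
  proof (rule sum.mono_neutral_right[OF finite_spectrum_in_I])
    show "(\<lambda>y. \<beta> * y + d) ` (beta_spectrum \<beta> \<inter> (I_interval \<beta> \<inter> branch_interval d)) \<subseteq> beta_spectrum \<beta> \<inter> I_interval \<beta>"
      using closed mem by auto
    show "\<forall>x\<in>beta_spectrum \<beta> \<inter> I_interval \<beta> - (\<lambda>y. \<beta> * y + d) ` (beta_spectrum \<beta> \<inter> (I_interval \<beta> \<inter> branch_interval d)).
            spectrum_mass \<beta> (?h x) = 0"
    proof (rule ballI, rule spectrum_mass_outside, rule notI)
      fix x assume x: "x \<in> beta_spectrum \<beta> \<inter> I_interval \<beta> - (\<lambda>y. \<beta> * y + d) ` (beta_spectrum \<beta> \<inter> (I_interval \<beta> \<inter> branch_interval d))"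
        and h: "?h x \<in> beta_spectrum \<beta>"
      have "x = \<beta> * ?h x + d" using \<beta>_gt_1 by simp
      moreover have "?h x \<in> branch_interval d" using x \<beta>_gt_1 by (simp add: mem)
      ultimately show False using x h sub by blast
    qed
  qed
  also have "\<dots> = (\<Sum>y\<in>beta_spectrum \<beta> \<inter> (I_interval \<beta> \<inter> branch_interval d). spectrum_mass \<beta> y)"
    using \<beta>_gt_1 by (subst sum.reindex) (auto simp: inj_on_def)
  finally show ?thesis .
qed

text \<open>The eigenvector equation of \<open>\<mu>\<close>, summed over \<open>I\<close>.\<close>
lemma growth_rate_eq_branches:
  "ennreal (growth_rate \<beta>) = emeasure (spectrum_prob \<beta>) (branch_interval 1) +
     2 * emeasure (spectrum_prob \<beta>) (branch_interval 0) + emeasure (spectrum_prob \<beta>) (branch_interval (-1))"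
proof -
  let ?s = "\<lambda>d. \<Sum>y\<in>beta_spectrum \<beta> \<inter> (I_interval \<beta> \<inter> branch_interval d). spectrum_mass \<beta> y"
  have s_nonneg: "?s d \<ge> 0" for d by (intro sum_nonneg spectrum_mass_nonneg)
  have "growth_rate \<beta> * total_mass = (\<Sum>x\<in>beta_spectrum \<beta> \<inter> I_interval \<beta>. digit_transfer \<beta> (spectrum_mass \<beta>) x)"
    by (simp add: total_mass_def sum_distrib_left spectrum_mass_eigen)
  also have "\<dots> = ?s 1 + 2 * ?s 0 + ?s (-1)"
    using sum_mass_preimage[of 1] sum_mass_preimage[of 0] sum_mass_preimage[of "-1"]
    by (simp add: digit_transfer_def sum.distrib sum_distrib_left[symmetric])
  finally have "growth_rate \<beta> = ?s 1 / total_mass + 2 * (?s 0 / total_mass) + ?s (-1) / total_mass"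
    using total_mass_pos by (simp add: field_simps)
  moreover have "emeasure (spectrum_prob \<beta>) (branch_interval d) = ennreal (?s d / total_mass)" for d
    by (rule emeasure_spectrum_prob) (simp add: branch_interval_def)
  ultimately show ?thesis using s_nonneg total_mass_pos by (simp only: ennreal_digit_sum divide_nonneg_pos)
qed

text \<open>Each of the three intervals has normalised length \<open>1 / \<beta>\<close>. Thickening by \<open>\<delta>\<close> adds at most \<open>\<delta>\<close>
  because \<open>I\<close> has length at least \<open>2\<close>, and the Markov term \<open>\<delta>\<^sup>2 / \<delta>\<close> adds another \<open>\<delta>\<close>; the weights
  sum to \<open>4\<close>.\<close>
lemma growth_rate_le_of_wasserstein:
  assumes \<delta>: "\<delta> > 0" and W: "wasserstein1 (spectrum_prob \<beta>) (lebesgue_prob \<beta>) < ennreal (\<delta>\<^sup>2)"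
  shows "growth_rate \<beta> \<le> 4 / \<beta> + 8 * \<delta>"
proof -
  obtain P where P: "P \<in> couplings (spectrum_prob \<beta>) (lebesgue_prob \<beta>)"
      "(\<integral>\<^sup>+ (x, y). ennreal (dist x y) \<partial>P) < ennreal (\<delta>\<^sup>2)"
    using W unfolding wasserstein1_def INF_less_iff by blast
  have branch_le: "emeasure (spectrum_prob \<beta>) (branch_interval d) \<le> ennreal (1 / \<beta> + 2 * \<delta>)" for d
  proof -
    define a b where "a = (-half_length - d) / \<beta>" and "b = (half_length - d) / \<beta>"
    have ba: "b - a = 2 * half_length / \<beta>" by (simp add: a_def b_def diff_divide_distrib)
    hence ab: "a \<le> b" using half_length_gt_1 \<beta>_gt_1 divide_nonneg_nonneg[of "2 * half_length" \<beta>] by linarith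
    have "emeasure (spectrum_prob \<beta>) {a..b} \<le> emeasure (lebesgue_prob \<beta>) {a - \<delta>..b + \<delta>} + (\<integral>\<^sup>+ (x, y). ennreal (dist x y) \<partial>P) / ennreal \<delta>"
      by (rule coupling_interval_le[OF P(1) \<delta>])
    also have "emeasure (lebesgue_prob \<beta>) {a - \<delta>..b + \<delta>} \<le> ennreal (1 / \<beta> + \<delta>)"
    proof -
      have "emeasure (lebesgue_prob \<beta>) {a - \<delta>..b + \<delta>} \<le> ennreal ((b + \<delta> - (a - \<delta>)) / (2 * half_length))"
        using ab \<delta> by (intro lebesgue_prob_interval_le) auto
      also have "(b + \<delta> - (a - \<delta>)) / (2 * half_length) = 1 / \<beta> + \<delta> / half_length"
      proof -
        have "b + \<delta> - (a - \<delta>) = 2 * half_length / \<beta> + 2 * \<delta>" using ba by linarith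
        thus ?thesis using half_length_gt_1 \<beta>_gt_1 by (simp add: add_divide_distrib)
      qed
      also have "\<dots> \<le> 1 / \<beta> + \<delta>" using half_length_gt_1 \<delta> by (simp add: field_simps)
      finally show ?thesis by (simp add: ennreal_leI)
    qed
    also have "(\<integral>\<^sup>+ (x, y). ennreal (dist x y) \<partial>P) / ennreal \<delta> \<le> ennreal (\<delta>\<^sup>2) / ennreal \<delta>"
      using P(2) by (intro divide_right_mono_ennreal) auto
    also have "\<dots> = ennreal \<delta>" using \<delta> by (simp add: divide_ennreal power2_eq_square)
    also have "ennreal (1 / \<beta> + \<delta>) + ennreal \<delta> = ennreal (1 / \<beta> + 2 * \<delta>)"
      using \<delta> \<beta>_gt_1 by (simp add: ennreal_plus[symmetric] del: ennreal_plus)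
    finally show ?thesis by (simp add: branch_interval_def a_def b_def add_mono)
  qed
  have "ennreal (growth_rate \<beta>) \<le> ennreal (1 / \<beta> + 2 * \<delta>) + 2 * ennreal (1 / \<beta> + 2 * \<delta>) + ennreal (1 / \<beta> + 2 * \<delta>)"
    unfolding growth_rate_eq_branches by (intro add_mono mult_left_mono branch_le) auto
  also have "\<dots> = ennreal (4 * (1 / \<beta> + 2 * \<delta>))"
  proof -
    define c where "c = 1 / \<beta> + 2 * \<delta>"
    have c: "c \<ge> 0" using \<delta> \<beta>_gt_1 by (simp add: c_def)
    have "ennreal c + 2 * ennreal c + ennreal c = ennreal (c + 2 * c + c)"
      by (rule ennreal_digit_sum[OF c c c, symmetric])
    also have "c + 2 * c + c = 4 * (1 / \<beta> + 2 * \<delta>)" by (simp add: c_def)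
    finally show ?thesis by (simp only: c_def)
  qed
  finally have "growth_rate \<beta> \<le> 4 * (1 / \<beta> + 2 * \<delta>)"
    using \<delta> \<beta>_gt_1 by (subst (asm) ennreal_le_iff) auto
  thus ?thesis by (simp add: algebra_simps)
qed

end

section \<open>Bernoulli convolutions as laws of random series\<close>
abbreviation coin :: "real measure" where
  "coin \<equiv> uniform_count_measure {0, 1 :: real}"

text \<open>One probability space for digit sequences of all lengths. The coordinate \<open>0\<close> is a dummy: digits are
  numbered from \<open>1\<close>.\<close>
definition coin_space :: "(nat \<Rightarrow> real) measure" where
  "coin_space = PiM UNIV (\<lambda>_. coin)"

abbreviation words :: "nat \<Rightarrow> (nat \<Rightarrow> real) set" where
  "words n \<equiv> {1..n} \<rightarrow>\<^sub>E {0, 1 :: real}"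

lemma finite_words: "finite (words n)"
  by (intro finite_PiE) auto

lemma card_words: "card (words n) = 2 ^ n"
  by (simp add: card_PiE numeral_2_eq_2)

interpretation coin: prob_space coin
  by (rule prob_space_uniform_count_measure) auto

interpretation coins: product_prob_space "\<lambda>_. coin" UNIV
  by unfold_locales

lemma prob_space_coin_space: "prob_space coin_space"
  unfolding coin_space_def by (rule coins.P.prob_space_axioms)

lemma space_coin_space: "space coin_space = UNIV \<rightarrow>\<^sub>E {0, 1}"
  by (simp add: coin_space_def space_PiM space_uniform_count_measure)

lemma coin_space_digit: "\<omega> \<in> space coin_space \<Longrightarrow> \<omega> i = 0 \<or> \<omega> i = 1"
  by (auto simp: space_coin_space PiE_iff)

lemma PiM_coin_words: "PiM {1..n} (\<lambda>_. coin) = uniform_count_measure (words n)"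
proof (rule measure_eqI_finite)
  have "sets (PiM {1..n} (\<lambda>_. coin)) = sets (PiM {1..n} (\<lambda>_. count_space {0, 1 :: real}))"
    by (intro sets_PiM_cong) (auto simp: sets_uniform_count_measure)
  also have "\<dots> = Pow (words n)" by (simp add: count_space_PiM_finite)
  finally show "sets (PiM {1..n} (\<lambda>_. coin)) = Pow (words n)" .
  show "sets (uniform_count_measure (words n)) = Pow (words n)" by (rule sets_uniform_count_measure)
  show "finite (words n)" by (rule finite_words)
next
  fix a assume a: "a \<in> words n"
  hence "{a} = (\<Pi>\<^sub>E i\<in>{1..n}. {a i})" by (simp add: PiE_singleton PiE_iff)
  hence "emeasure (PiM {1..n} (\<lambda>_. coin)) {a} = (\<Prod>i\<in>{1..n}. emeasure coin {a i})"
    using a by (simp only:) (intro coins.emeasure_PiM; auto simp: sets_uniform_count_measure PiE_iff)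
  also have "\<dots> = (\<Prod>i\<in>{1..n}. ennreal (1 / 2))"
    using a by (intro prod.cong refl) (auto simp: emeasure_uniform_count_measure PiE_iff)
  also have "\<dots> = ennreal ((1 / 2) ^ n)" by (subst ennreal_power[symmetric]) simp_all
  also have "\<dots> = emeasure (uniform_count_measure (words n)) {a}"
    using a finite_words card_words[of n] by (simp add: emeasure_uniform_count_measure power_one_over)
  finally show "emeasure (PiM {1..n} (\<lambda>_. coin)) {a} = emeasure (uniform_count_measure (words n)) {a}" .
qed

lemma distr_coin_space_prefix:
  "distr coin_space (uniform_count_measure (words n)) (\<lambda>\<omega>. restrict \<omega> {1..n}) = uniform_count_measure (words n)"
  using coins.distr_PiM_restrict_finite[of "{1..n}"] by (simp only: coin_space_def PiM_coin_words) simp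

lemma measurable_prefix:
  "(\<lambda>\<omega>. restrict \<omega> {1..n}) \<in> coin_space \<rightarrow>\<^sub>M uniform_count_measure (words n)"
  unfolding coin_space_def PiM_coin_words[symmetric] by (rule measurable_restrict_subset) auto

definition cylinder :: "nat \<Rightarrow> (nat \<Rightarrow> real) set \<Rightarrow> (nat \<Rightarrow> real) set" where
  "cylinder n A = {\<omega> \<in> space coin_space. restrict \<omega> {1..n} \<in> A}"

lemma cylinder_sets:
  assumes "A \<subseteq> words n" shows "cylinder n A \<in> sets coin_space"
proof -
  have "(\<lambda>\<omega>. restrict \<omega> {1..n}) -` A \<inter> space coin_space \<in> sets coin_space"
    using assms by (intro measurable_sets[OF measurable_prefix]) (auto simp: sets_uniform_count_measure)
  thus ?thesis by (simp add: cylinder_def vimage_def Int_def conj_commute)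
qed

lemma emeasure_cylinder:
  assumes "A \<subseteq> words n" shows "emeasure coin_space (cylinder n A) = ennreal (card A / 2 ^ n)"
proof -
  have "emeasure coin_space (cylinder n A) = emeasure (uniform_count_measure (words n)) A"
  proof -
    have "emeasure (uniform_count_measure (words n)) A =
        emeasure coin_space ((\<lambda>\<omega>. restrict \<omega> {1..n}) -` A \<inter> space coin_space)"
      using emeasure_distr[OF measurable_prefix, of A n] assms
      by (simp only: distr_coin_space_prefix sets_uniform_count_measure Pow_iff)
    thus ?thesis by (simp add: cylinder_def vimage_def Int_def conj_commute)
  qed
  thus ?thesis using assms finite_words card_words[of n] by (simp add: emeasure_uniform_count_measure)
qed

lemma prefix_in_words: "\<omega> \<in> space coin_space \<Longrightarrow> restrict \<omega> {1..n} \<in> words n"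
  by (auto simp: space_coin_space PiE_iff)

lemma measurable_coordinate [measurable]: "(\<lambda>\<omega>. \<omega> i) \<in> borel_measurable coin_space"
proof -
  have "(\<lambda>\<omega>. \<omega> i) \<in> coin_space \<rightarrow>\<^sub>M coin" unfolding coin_space_def by (rule measurable_component_singleton) simp
  moreover have "(\<lambda>x. x) \<in> coin \<rightarrow>\<^sub>M borel" by (auto intro!: measurableI simp: sets_uniform_count_measure)
  ultimately show ?thesis by (rule measurable_compose)
qed

definition digit_sum :: "real \<Rightarrow> nat \<Rightarrow> (nat \<Rightarrow> real) \<Rightarrow> real" where
  "digit_sum \<beta> n \<omega> = (\<Sum>i=1..n. \<omega> i * (1 / \<beta>) ^ i)"

definition digit_series :: "real \<Rightarrow> (nat \<Rightarrow> real) \<Rightarrow> real" where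
  "digit_series \<beta> \<omega> = (\<Sum>i. \<omega> (Suc i) * (1 / \<beta>) ^ Suc i)"

lemma digit_sum_measurable [measurable]: "digit_sum \<beta> n \<in> borel_measurable coin_space"
  unfolding digit_sum_def[abs_def] by measurable

lemma digit_series_measurable [measurable]: "digit_series \<beta> \<in> borel_measurable coin_space"
  unfolding digit_series_def[abs_def] by measurable

lemma digit_series_bounds:
  assumes \<beta>: "\<beta> > 1" and \<omega>: "\<omega> \<in> space coin_space"
  shows "digit_sum \<beta> n \<omega> \<le> digit_series \<beta> \<omega>"
    and "digit_series \<beta> \<omega> \<le> digit_sum \<beta> n \<omega> + (1 / \<beta>) ^ n / (\<beta> - 1)"
proof -
  define g where "g = (\<lambda>i. \<omega> (Suc i) * (1 / \<beta>) ^ Suc i)"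
  have g: "0 \<le> g i" "g i \<le> (1 / \<beta>) ^ Suc i" for i
    using coin_space_digit[OF \<omega>, of "Suc i"] \<beta> unfolding g_def by auto
  have geo: "(\<lambda>i. (1 / \<beta>) ^ i) sums (1 / (1 - 1 / \<beta>))" using \<beta> by (intro geometric_sums) simp
  have sg: "summable g"
  proof (rule summable_comparison_test')
    show "summable (\<lambda>i. (1 / \<beta>) ^ Suc i)" using \<beta> by (simp add: summable_Suc_iff summable_geometric del: power_Suc)
    show "norm (g i) \<le> (1 / \<beta>) ^ Suc i" if "i \<ge> 0" for i using g[of i] by simp
  qed
  have split: "digit_series \<beta> \<omega> = (\<Sum>i. g (i + n)) + digit_sum \<beta> n \<omega>"
  proof -
    have "digit_sum \<beta> n \<omega> = (\<Sum>i<n. g i)" unfolding digit_sum_def g_def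
      by (rule sum.reindex_bij_witness[of _ Suc "\<lambda>i. i - 1"]) auto
    thus ?thesis using suminf_split_initial_segment[OF sg, of n] by (simp add: digit_series_def g_def)
  qed
  have sgn: "summable (\<lambda>i. g (i + n))" using sg by (simp add: summable_iff_shift)
  show "digit_sum \<beta> n \<omega> \<le> digit_series \<beta> \<omega>"
    unfolding split using g sgn by (simp add: suminf_nonneg)
  have "(\<Sum>i. g (i + n)) \<le> (\<Sum>i. (1 / \<beta>) ^ Suc n * (1 / \<beta>) ^ i)"
  proof (rule suminf_le[OF _ sgn])
    show "g (i + n) \<le> (1 / \<beta>) ^ Suc n * (1 / \<beta>) ^ i" for i
      using g(2)[of "i + n"] by (simp add: power_add mult_ac)
    show "summable (\<lambda>i. (1 / \<beta>) ^ Suc n * (1 / \<beta>) ^ i)" using geo by (intro summable_mult) (rule sums_summable)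
  qed
  also have "\<dots> = (1 / \<beta>) ^ Suc n * (1 / (1 - 1 / \<beta>))"
    using geo by (intro sums_unique[symmetric] sums_mult)
  also have "\<dots> = (1 / \<beta>) ^ n / (\<beta> - 1)" using \<beta> by (simp add: field_simps)
  finally show "digit_series \<beta> \<omega> \<le> digit_sum \<beta> n \<omega> + (1 / \<beta>) ^ n / (\<beta> - 1)" unfolding split by simp
qed

lemma bernoulli_approx_eq_distr: "bernoulli_approx \<beta> n = distr coin_space borel (digit_sum \<beta> n)"
proof -
  have meas: "(\<lambda>a. \<Sum>i=1..n. a i * (1 / \<beta>) ^ i) \<in> uniform_count_measure (words n) \<rightarrow>\<^sub>M borel"
    by (rule measurableI) (simp_all add: sets_uniform_count_measure space_uniform_count_measure)
  have "bernoulli_approx \<beta> n = distr coin_space borel ((\<lambda>a. \<Sum>i=1..n. a i * (1 / \<beta>) ^ i) \<circ> (\<lambda>\<omega>. restrict \<omega> {1..n}))"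
    unfolding bernoulli_approx_def
    by (subst distr_coin_space_prefix[symmetric], subst distr_distr[OF meas measurable_prefix]) simp
  also have "(\<lambda>a. \<Sum>i=1..n. a i * (1 / \<beta>) ^ i) \<circ> (\<lambda>\<omega>. restrict \<omega> {1..n}) = digit_sum \<beta> n"
    by (auto simp: digit_sum_def fun_eq_iff intro!: sum.cong)
  finally show ?thesis .
qed

lemma real_distribution_distr_coin_space:
  assumes "X \<in> borel_measurable coin_space"
  shows "real_distribution (distr coin_space borel X)"
proof -
  have "prob_space (distr coin_space borel X)"
    using prob_space.prob_space_distr[OF prob_space_coin_space assms] .
  thus ?thesis by (simp add: real_distribution_def real_distribution_axioms_def)
qed

text \<open>The partial sums differ from the series by at most \<open>c\<^sub>n = \<beta>\<^sup>-\<^sup>n / (\<beta> - 1)\<close> and lie below it, so the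
  distribution function of the \<open>n\<close>-th approximation at \<open>x\<close> lies between \<open>F(x)\<close> and \<open>F(x + c\<^sub>n)\<close>.\<close>
lemma bernoulli_approx_weak_limit:
  assumes \<beta>: "\<beta> > 1"
  shows "weak_conv_m (bernoulli_approx \<beta>) (distr coin_space borel (digit_series \<beta>))"
proof -
  interpret prob_space coin_space by (rule prob_space_coin_space)
  define F where "F = cdf (distr coin_space borel (digit_series \<beta>))"
  define c where "c = (\<lambda>n. (1 / \<beta>) ^ n / (\<beta> - 1))"
  have cdf_eq: "cdf (distr coin_space borel X) x = prob {\<omega> \<in> space coin_space. X \<omega> \<le> x}"
    if [measurable]: "X \<in> borel_measurable coin_space" for X x
    by (simp add: cdf_def measure_distr vimage_def Int_def conj_commute)
  have "(\<lambda>n. (1 / \<beta>) ^ n / (\<beta> - 1)) \<longlonglongrightarrow> 0"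
    using \<beta> by (intro tendsto_divide_zero LIMSEQ_realpow_zero) auto
  hence c0: "c \<longlonglongrightarrow> 0" by (simp add: c_def)
  have "(\<lambda>n. cdf (bernoulli_approx \<beta> n) x) \<longlonglongrightarrow> F x" if x: "isCont F x" for x
  proof (rule tendsto_sandwich)
    show "\<forall>\<^sub>F n in sequentially. F x \<le> cdf (bernoulli_approx \<beta> n) x"
    proof (intro always_eventually allI)
      fix n
      have "{\<omega> \<in> space coin_space. digit_series \<beta> \<omega> \<le> x} \<subseteq> {\<omega> \<in> space coin_space. digit_sum \<beta> n \<omega> \<le> x}"
        using digit_series_bounds(1)[OF \<beta>] by (blast intro: order_trans)
      thus "F x \<le> cdf (bernoulli_approx \<beta> n) x"
        unfolding F_def bernoulli_approx_eq_distr by (subst (1 2) cdf_eq) (auto intro!: finite_measure_mono)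
    qed
    show "\<forall>\<^sub>F n in sequentially. cdf (bernoulli_approx \<beta> n) x \<le> F (x + c n)"
    proof (intro always_eventually allI)
      fix n
      have "{\<omega> \<in> space coin_space. digit_sum \<beta> n \<omega> \<le> x} \<subseteq> {\<omega> \<in> space coin_space. digit_series \<beta> \<omega> \<le> x + c n}"
        using digit_series_bounds(2)[OF \<beta>, of _ n] by (force simp: c_def)
      thus "cdf (bernoulli_approx \<beta> n) x \<le> F (x + c n)"
        unfolding F_def bernoulli_approx_eq_distr by (subst (1 2) cdf_eq) (auto intro!: finite_measure_mono)
    qed
    have "(\<lambda>n. x + c n) \<longlonglongrightarrow> x + 0" by (intro tendsto_intros c0)
    thus "(\<lambda>n. F (x + c n)) \<longlonglongrightarrow> F x" using x by (auto intro: isCont_tendsto_compose)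
  qed simp
  thus ?thesis by (simp add: weak_conv_m_def weak_conv_def F_def)
qed

text \<open>Weak limits are unique since they determine the characteristic function.\<close>
lemma bernoulli_convolution_eq_distr:
  assumes "\<beta> > 1"
  shows "bernoulli_convolution \<beta> = distr coin_space borel (digit_series \<beta>)"
  unfolding bernoulli_convolution_def
proof (rule the_equality)
  let ?\<nu> = "distr coin_space borel (digit_series \<beta>)"
  have rd: "real_distribution ?\<nu>" by (rule real_distribution_distr_coin_space) simp
  show "real_distribution ?\<nu> \<and> weak_conv_m (bernoulli_approx \<beta>) ?\<nu>"
    using rd bernoulli_approx_weak_limit[OF assms] by simp
  fix M assume M: "real_distribution M \<and> weak_conv_m (bernoulli_approx \<beta>) M"
  have approx: "real_distribution (bernoulli_approx \<beta> n)" for n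
    unfolding bernoulli_approx_eq_distr by (rule real_distribution_distr_coin_space) simp
  have "char M t = char ?\<nu> t" for t
    using levy_continuity1[where M = "bernoulli_approx \<beta>" and M' = M and t = t]
      levy_continuity1[where M = "bernoulli_approx \<beta>" and M' = "?\<nu>" and t = t]
      approx rd bernoulli_approx_weak_limit[OF assms] M LIMSEQ_unique by blast
  thus "M = ?\<nu>" using M rd by (intro Levy_uniqueness) auto
qed

section \<open>The correlation dimension bounds the Hausdorff dimension\<close>

text \<open>For \<open>d > 0\<close> the scale is the largest \<open>n\<close> with \<open>d \<le> \<beta>\<^sup>-\<^sup>n\<close>. The slack \<open>\<eta>\<close> is for covering sets that
  consist of a single point, where any large \<open>n\<close> will do.\<close>
lemma exists_scale:
  fixes \<beta> s d :: real
  assumes \<beta>: "\<beta> > 1" and s: "s > 0" and d: "0 \<le> d" "d \<le> (1 / \<beta>) ^ n0" and \<eta>: "\<eta> > 0"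
  shows "\<exists>n\<ge>n0. d \<le> (1 / \<beta>) ^ n \<and> 1 / (\<beta> powr s) ^ n \<le> \<beta> powr s * d powr s + \<eta>"
proof (cases "d = 0")
  case True
  have "1 < \<beta> powr s" using \<beta> s by simp
  hence "(\<lambda>n. (1 / \<beta> powr s) ^ n) \<longlonglongrightarrow> 0" by (intro LIMSEQ_realpow_zero) (auto simp: divide_less_eq)
  hence "eventually (\<lambda>n. (1 / \<beta> powr s) ^ n < \<eta>) sequentially" using \<eta> by (rule order_tendstoD(2))
  then obtain n where "n \<ge> n0" "(1 / \<beta> powr s) ^ n < \<eta>"
    unfolding eventually_sequentially by (meson le_cases order_trans linorder_le_cases)
  thus ?thesis using True \<beta> by (intro exI[of _ n]) (auto simp: power_one_over)
next
  case False
  hence d0: "d > 0" using d by simp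
  have "(\<lambda>n. (1 / \<beta>) ^ n) \<longlonglongrightarrow> 0" using \<beta> by (intro LIMSEQ_realpow_zero) auto
  hence "eventually (\<lambda>n. (1 / \<beta>) ^ n < d) sequentially" using d0 by (rule order_tendstoD(2))
  then obtain k where "(1 / \<beta>) ^ k < d" by (auto simp: eventually_sequentially)
  define m where "m = (LEAST n. (1 / \<beta>) ^ n < d)"
  have m: "(1 / \<beta>) ^ m < d" unfolding m_def by (rule LeastI) fact
  have "m > n0"
  proof (rule ccontr)
    assume "\<not> m > n0"
    hence "(1 / \<beta>) ^ n0 \<le> (1 / \<beta>) ^ m" using \<beta> by (intro power_decreasing) auto
    thus False using m d by linarith
  qed
  then obtain n where n: "m = Suc n" "n \<ge> n0" by (cases m) auto
  have "\<not> (1 / \<beta>) ^ n < d" using not_less_Least[of n "\<lambda>n. (1 / \<beta>) ^ n < d"] n by (simp add: m_def)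
  moreover have "1 / (\<beta> powr s) ^ n \<le> \<beta> powr s * d powr s"
  proof -
    have "((1 / \<beta>) ^ m) powr s \<le> d powr s" using m \<beta> s by (intro powr_mono2) auto
    moreover have "((1 / \<beta>) ^ m) powr s = 1 / (\<beta> powr s) ^ m"
      using \<beta> by (simp add: power_one_over powr_divide powr_power powr_realpow[symmetric] powr_powr mult.commute)
    ultimately have "1 / (\<beta> powr s) ^ Suc n \<le> d powr s" by (simp add: n)
    hence "\<beta> powr s * (1 / (\<beta> powr s) ^ Suc n) \<le> \<beta> powr s * d powr s" by (intro mult_left_mono) auto
    thus ?thesis using \<beta> by simp
  qed
  ultimately show ?thesis using n \<eta> by (intro exI[of _ n]) auto
qed

lemma powr_diameter_le_hausdorff_weight:
  assumes "U \<noteq> {}" "0 \<le> t" "t \<le> s" "0 < s" "bounded U" "diameter U \<le> 1"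
  shows "ennreal (diameter U powr s) \<le> hausdorff_weight t U"
proof (cases "t = 0")
  case True
  have "diameter U powr s \<le> 1" using assms diameter_ge_0[of U] by (intro powr_le1) auto
  thus ?thesis using True assms by (simp add: hausdorff_weight_def ennreal_le_1)
next
  case False
  have "diameter U powr s \<le> diameter U powr t" using assms diameter_ge_0[of U] by (intro powr_mono') auto
  thus ?thesis using False assms by (simp add: hausdorff_weight_def ennreal_leI)
qed

context pisot_base
begin

definition word_value :: "nat \<Rightarrow> (nat \<Rightarrow> real) \<Rightarrow> real" where
  "word_value n a = (\<Sum>i=1..n. a i * \<beta> ^ (n - i))"

lemma digit_sum_eq_val: "digit_sum \<beta> n \<omega> = word_value n (restrict \<omega> {1..n}) / \<beta> ^ n"
proof -
  have "\<omega> i * (1 / \<beta>) ^ i = restrict \<omega> {1..n} i * \<beta> ^ (n - i) / \<beta> ^ n" if "i \<in> {1..n}" for i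
    using that \<beta>_gt_1 by (simp add: power_diff power_one_over)
  thus ?thesis unfolding digit_sum_def word_value_def sum_divide_distrib by (intro sum.cong) auto
qed

text \<open>The radius \<open>2 + half_length\<close> is such that two digit sequences whose series differ by at most
  \<open>2 \<beta>\<^sup>-\<^sup>n\<close> have near prefixes of length \<open>n\<close>.\<close>
definition near_words :: "nat \<Rightarrow> (nat \<Rightarrow> real) \<Rightarrow> (nat \<Rightarrow> real) set" where
  "near_words n a = {b \<in> words n. \<bar>word_value n b - word_value n a\<bar> \<le> 2 + half_length}"

lemma finite_near_words: "finite (near_words n a)"
  unfolding near_words_def using finite_words by simp

text \<open>The number of near pairs is \<open>\<Sum> N\<^sub>n(x)\<close> over the finitely many \<open>x\<close> of the spectrum within the radius,
  and each term is at most \<open>N\<^sub>n(0)\<close>.\<close>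
lemma sum_card_near_words_le:
  obtains C where "C > 0" "\<And>n. (\<Sum>a\<in>words n. real (card (near_words n a))) \<le> C * growth_rate \<beta> ^ n"
proof -
  define F where "F = beta_spectrum \<beta> \<inter> {- (2 + half_length)..2 + half_length}"
  have F: "finite F" unfolding F_def by (rule finite_beta_spectrum_bounded[OF pisot])
  define Q where "Q = (\<lambda>n x. {(a, b). a \<in> words n \<and> b \<in> words n \<and> (\<Sum>i=1..n. (a i - b i) * \<beta> ^ (n - i)) = x})"
  have finQ: "finite (Q n x)" for n x
    by (rule finite_subset[OF _ finite_cartesian_product[OF finite_words finite_words]]) (auto simp: Q_def)
  have NQ: "num_reps \<beta> n x = card (Q n x)" for n x by (simp add: num_reps_def Q_def)
  obtain C where C: "C > 0" "\<And>n. N n 0 \<le> C * growth_rate \<beta> ^ n" by (rule N_0_growth_bound) blast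
  show ?thesis
  proof (rule that[of "real (card F) * C + 1"])
    show "real (card F) * C + 1 > 0" using C by (simp add: add_nonneg_pos)
    fix n
    have "(SIGMA a:words n. near_words n a) \<subseteq> (\<Union>x\<in>F. Q n x)"
    proof
      fix p assume p: "p \<in> (SIGMA a:words n. near_words n a)"
      obtain a b where ab: "p = (a, b)" by fastforce
      have w: "a \<in> words n" "b \<in> words n" "\<bar>word_value n b - word_value n a\<bar> \<le> 2 + half_length"
        using p by (auto simp: ab near_words_def)
      define x where "x = word_value n a - word_value n b"
      have "(\<Sum>i=1..n. (a i - b i) * \<beta> ^ (n - i)) = x"
        by (simp add: x_def word_value_def left_diff_distrib sum_subtractf)
      hence pQ: "p \<in> Q n x" using w by (simp add: Q_def ab)
      hence "num_reps \<beta> n x > 0" unfolding NQ using finQ card_gt_0_iff by blast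
      hence "x \<in> F" using w(3) beta_spectrum_iff_num_reps_pos[of x \<beta>] by (auto simp: F_def x_def)
      thus "p \<in> (\<Union>x\<in>F. Q n x)" using pQ by blast
    qed
    hence "card (SIGMA a:words n. near_words n a) \<le> card (\<Union>x\<in>F. Q n x)" using F finQ by (intro card_mono) auto
    also have "\<dots> \<le> (\<Sum>x\<in>F. card (Q n x))" by (rule card_UN_le[OF F])
    also have "\<dots> \<le> (\<Sum>x\<in>F. num_reps \<beta> n 0)" by (intro sum_mono) (simp add: num_reps_le_num_reps_0 flip: NQ)
    finally have "(\<Sum>a\<in>words n. card (near_words n a)) \<le> card F * num_reps \<beta> n 0"
      by (simp add: card_SigmaI finite_words finite_near_words del: One_nat_def)
    hence "(\<Sum>a\<in>words n. real (card (near_words n a))) \<le> real (card F) * N n 0"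
      by (metis of_nat_le_iff of_nat_mult of_nat_sum)
    also have "\<dots> \<le> real (card F) * (C * growth_rate \<beta> ^ n)" by (intro mult_left_mono C) auto
    also have "\<dots> \<le> (real (card F) * C + 1) * growth_rate \<beta> ^ n"
      using growth_rate_props(1) by (simp add: algebra_simps)
    finally show "(\<Sum>a\<in>words n. real (card (near_words n a))) \<le> (real (card F) * C + 1) * growth_rate \<beta> ^ n" .
  qed
qed

text \<open>Words with so many neighbours that the Bernoulli convolution may give an interval of length \<open>\<beta>\<^sup>-\<^sup>n\<close>
  near their value a mass exceeding \<open>h\<^sup>-\<^sup>n\<close>. In the application \<open>h = \<beta>\<^sup>s\<close>.\<close>
definition heavy_words :: "real \<Rightarrow> nat \<Rightarrow> (nat \<Rightarrow> real) set" where
  "heavy_words h n = {a \<in> words n. real (card (near_words n a)) > 2 ^ n / h ^ n}"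

lemma heavy_words_subset: "heavy_words h n \<subseteq> words n"
  by (auto simp: heavy_words_def)

text \<open>Markov's inequality for the number of words near a random one.\<close>
lemma emeasure_heavy_words_le:
  assumes h: "h > 0"
  obtains C where "C > 0" "\<And>n. emeasure coin_space (cylinder n (heavy_words h n)) \<le> ennreal (C * (growth_rate \<beta> * h / 4) ^ n)"
proof -
  obtain C where C: "C > 0" "\<And>n. (\<Sum>a\<in>words n. real (card (near_words n a))) \<le> C * growth_rate \<beta> ^ n"
    by (rule sum_card_near_words_le) blast
  show ?thesis
  proof (rule that[OF C(1)])
    fix n
    have "real (card (heavy_words h n)) * (2 ^ n / h ^ n) = (\<Sum>a\<in>heavy_words h n. 2 ^ n / h ^ n)" by simp
    also have "\<dots> \<le> (\<Sum>a\<in>heavy_words h n. real (card (near_words n a)))"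
      by (intro sum_mono) (auto simp: heavy_words_def)
    also have "\<dots> \<le> (\<Sum>a\<in>words n. real (card (near_words n a)))"
      by (intro sum_mono2 finite_words heavy_words_subset) auto
    also have "\<dots> \<le> C * growth_rate \<beta> ^ n" by (rule C)
    finally have "real (card (heavy_words h n)) / 2 ^ n \<le> C * growth_rate \<beta> ^ n * h ^ n / (2 ^ n * 2 ^ n)"
      using h by (simp add: field_simps)
    also have "\<dots> = C * (growth_rate \<beta> * h / 4) ^ n"
      by (simp add: power_divide power_mult_distrib flip: power_mult_distrib[of 2 2])
    finally show "emeasure coin_space (cylinder n (heavy_words h n)) \<le> ennreal (C * (growth_rate \<beta> * h / 4) ^ n)"
      by (simp add: emeasure_cylinder[OF heavy_words_subset] ennreal_leI)
  qed
qed

definition light_event :: "real \<Rightarrow> nat \<Rightarrow> real \<Rightarrow> real \<Rightarrow> (nat \<Rightarrow> real) set" where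
  "light_event h n u r =
     {\<omega> \<in> space coin_space. restrict \<omega> {1..n} \<notin> heavy_words h n \<and> \<bar>digit_series \<beta> \<omega> - u\<bar> \<le> r}"

lemma light_event_sets: "light_event h n u r \<in> sets coin_space"
proof -
  have "light_event h n u r = {\<omega> \<in> space coin_space. \<bar>digit_series \<beta> \<omega> - u\<bar> \<le> r} - cylinder n (heavy_words h n)"
    by (auto simp: light_event_def cylinder_def)
  also have "\<dots> \<in> sets coin_space"
    by (intro sets.Diff cylinder_sets heavy_words_subset) measurable
  finally show ?thesis .
qed

text \<open>The prefixes occurring in the event are pairwise near. As one of them is not heavy, there are at most
  \<open>2\<^sup>n / h\<^sup>n\<close> of them.\<close>
lemma emeasure_light_event_le:
  assumes h: "h > 0" and r: "r \<le> (1 / \<beta>) ^ n"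
  shows "emeasure coin_space (light_event h n u r) \<le> ennreal (1 / h ^ n)"
proof -
  \<comment> \<open>The series exceeds its \<open>n\<close>-th partial sum by at most \<open>half_length * (1 / \<beta>) ^ n\<close>.\<close>
  define B where "B = {a \<in> words n - heavy_words h n. word_value n a / \<beta> ^ n \<in> {u - r - half_length * (1 / \<beta>) ^ n..u + r}}"
  have sub: "light_event h n u r \<subseteq> cylinder n B"
  proof
    fix \<omega> assume \<omega>: "\<omega> \<in> light_event h n u r"
    hence sp: "\<omega> \<in> space coin_space" by (simp add: light_event_def)
    have "digit_sum \<beta> n \<omega> \<le> digit_series \<beta> \<omega>" "digit_series \<beta> \<omega> \<le> digit_sum \<beta> n \<omega> + half_length * (1 / \<beta>) ^ n"
      using digit_series_bounds[OF \<beta>_gt_1 sp, of n] by (simp_all add: half_length_def)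
    moreover have "\<bar>digit_series \<beta> \<omega> - u\<bar> \<le> r" using \<omega> by (simp add: light_event_def)
    ultimately have "digit_sum \<beta> n \<omega> \<in> {u - r - half_length * (1 / \<beta>) ^ n..u + r}" by auto
    thus "\<omega> \<in> cylinder n B"
      using \<omega> sp prefix_in_words[OF sp, of n] by (simp add: cylinder_def B_def light_event_def digit_sum_eq_val)
  qed
  have Bw: "B \<subseteq> words n" by (auto simp: B_def)
  have "real (card B) \<le> 2 ^ n / h ^ n"
  proof (cases "B = {}")
    case False
    then obtain a where a: "a \<in> B" by blast
    have "B \<subseteq> near_words n a"
    proof
      fix b assume b: "b \<in> B"
      have "\<bar>word_value n b / \<beta> ^ n - word_value n a / \<beta> ^ n\<bar> \<le> 2 * r + half_length * (1 / \<beta>) ^ n"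
        using a b by (auto simp: B_def)
      also have "\<dots> \<le> (2 + half_length) * (1 / \<beta>) ^ n" using r by (simp add: algebra_simps)
      also have "word_value n b / \<beta> ^ n - word_value n a / \<beta> ^ n = (word_value n b - word_value n a) / \<beta> ^ n" by (simp add: diff_divide_distrib)
      finally have "\<bar>word_value n b - word_value n a\<bar> \<le> 2 + half_length"
        using \<beta>_gt_1 by (simp add: power_one_over field_simps)
      thus "b \<in> near_words n a" using b by (simp add: near_words_def B_def)
    qed
    hence "card B \<le> card (near_words n a)" by (intro card_mono finite_near_words)
    moreover have "real (card (near_words n a)) \<le> 2 ^ n / h ^ n" using a by (auto simp: B_def heavy_words_def)
    ultimately show ?thesis by linarith
  qed (use h in simp)
  hence "real (card B) / 2 ^ n \<le> 1 / h ^ n" using h by (simp add: field_simps)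
  moreover have "emeasure coin_space (light_event h n u r) \<le> emeasure coin_space (cylinder n B)"
    by (intro emeasure_mono sub cylinder_sets Bw)
  ultimately show ?thesis by (simp add: emeasure_cylinder[OF Bw]) (meson ennreal_leI order_trans)
qed

text \<open>Suppose that \<open>A\<close> has covers by sets \<open>U\<^sub>i\<close> of arbitrarily small weight. The digit sequences with a
  heavy prefix of some length at least \<open>n\<^sub>0\<close> have small probability, since
  \<open>\<kappa> = l \<beta>\<^sup>s / 4 < 1\<close>. The others fall into \<open>U\<^sub>i\<close> with probability at most of the order of
  the weight of \<open>U\<^sub>i\<close>. Both contributions are less than or equal to \<open>1/2\<close>, the first one strictly, and
  so \<open>A\<close> cannot have full measure.\<close>
lemma hausdorff_measure_full_set_nonzero:
  assumes s: "s > 0" "growth_rate \<beta> * \<beta> powr s < 4" and t: "0 \<le> t" "t \<le> s"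
    and A: "A \<in> sets borel" "emeasure (bernoulli_convolution \<beta>) A = 1"
  shows "hausdorff_measure t A \<noteq> 0"
proof
  assume null: "hausdorff_measure t A = 0"
  define h where "h = \<beta> powr s"
  have h: "h > 1" using s \<beta>_gt_1 by (simp add: h_def)
  obtain C where C: "C > 0" "\<And>n. emeasure coin_space (cylinder n (heavy_words h n)) \<le> ennreal (C * (growth_rate \<beta> * h / 4) ^ n)"
    by (rule emeasure_heavy_words_le[of h]) (use h in auto)
  define \<kappa> where "\<kappa> = growth_rate \<beta> * h / 4"
  have \<kappa>: "0 < \<kappa>" "\<kappa> < 1"
    using s(2) growth_rate_props(1) h by (auto simp: \<kappa>_def h_def intro!: mult_pos_pos)
  have "(\<lambda>n. C * \<kappa> ^ n / (1 - \<kappa>)) \<longlonglongrightarrow> C * 0 / (1 - \<kappa>)"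
    using \<kappa> by (intro tendsto_intros LIMSEQ_realpow_zero) auto
  hence "eventually (\<lambda>n. C * \<kappa> ^ n / (1 - \<kappa>) < 1 / 2) sequentially"
    by (rule order_tendstoD(2)) simp
  then obtain n0 where n0: "C * \<kappa> ^ n0 / (1 - \<kappa>) < 1 / 2" by (auto simp: eventually_sequentially)
  define \<delta> where "\<delta> = (1 / \<beta>) ^ n0"
  have \<delta>: "\<delta> > 0" "\<delta> \<le> 1" using \<beta>_gt_1 by (auto simp: \<delta>_def power_le_one)
  have "hausdorff_content t \<delta> A \<le> hausdorff_measure t A"
    unfolding hausdorff_measure_def using \<delta> by (intro SUP_upper) auto
  hence "hausdorff_content t \<delta> A < ennreal (1 / (4 * h))" using null h by simp
  then obtain U :: "nat \<Rightarrow> real set" where U: "\<And>i. bounded (U i)" "\<And>i. diameter (U i) \<le> \<delta>" "A \<subseteq> (\<Union>i. U i)"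
      and Usum: "(\<Sum>i. hausdorff_weight t (U i)) < ennreal (1 / (4 * h))"
    unfolding hausdorff_content_def INF_less_iff by blast
  \<comment> \<open>Positive slacks with sum \<open>1/4\<close>; the weights contribute \<open>h * (1 / (4 * h)) = 1/4\<close>.\<close>
  define \<eta> where "\<eta> = (\<lambda>i::nat. (1 / 2 :: real) ^ i * (1 / 8))"
  have d0: "0 \<le> diameter (U i)" for i using U(1) by (rule diameter_ge_0)
  have "\<forall>i. \<exists>n\<ge>n0. diameter (U i) \<le> (1 / \<beta>) ^ n \<and> 1 / h ^ n \<le> h * diameter (U i) powr s + \<eta> i"
    unfolding h_def using d0 U(2) s(1) \<beta>_gt_1
    by (intro allI exists_scale) (auto simp: \<delta>_def \<eta>_def)
  then obtain n where n: "\<And>i. n i \<ge> n0" "\<And>i. diameter (U i) \<le> (1 / \<beta>) ^ n i"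
      "\<And>i. 1 / h ^ n i \<le> h * diameter (U i) powr s + \<eta> i" by metis
  define u where "u = (\<lambda>i. SOME x. x \<in> U i)"
  define E where "E = (\<lambda>i. if U i = {} then {} else light_event h (n i) (u i) (diameter (U i)))"
  define H where "H = (\<lambda>j. cylinder (n0 + j) (heavy_words h (n0 + j)))"
  have E_sets: "range E \<subseteq> sets coin_space" by (auto simp: E_def light_event_sets)
  have H_sets: "range H \<subseteq> sets coin_space" unfolding H_def using cylinder_sets[OF heavy_words_subset] by blast
  have \<eta>_pos: "\<eta> i \<ge> 0" for i by (simp add: \<eta>_def)
  have E_le: "emeasure coin_space (E i) \<le> ennreal h * hausdorff_weight t (U i) + ennreal (\<eta> i)" for i
  proof (cases "U i = {}")
    case False
    have "emeasure coin_space (E i) \<le> ennreal (1 / h ^ n i)"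
      using False h n(2) by (simp add: E_def emeasure_light_event_le)
    also have "\<dots> \<le> ennreal (h * diameter (U i) powr s + \<eta> i)" by (intro ennreal_leI n)
    also have "\<dots> = ennreal h * ennreal (diameter (U i) powr s) + ennreal (\<eta> i)"
      using h \<eta>_pos by (simp add: ennreal_plus ennreal_mult)
    also have "\<dots> \<le> ennreal h * hausdorff_weight t (U i) + ennreal (\<eta> i)"
      using False t s U(1,2) \<delta> 
      by (intro add_mono mult_left_mono powr_diameter_le_hausdorff_weight) (auto intro: order_trans)
    finally show ?thesis .
  qed (simp add: E_def)
  have \<eta>_sum: "(\<Sum>i. ennreal (\<eta> i)) = ennreal (1 / 4)"
  proof -
    have "\<eta> sums (1 / (1 - 1 / 2) * (1 / 8))" unfolding \<eta>_def by (intro sums_mult2 geometric_sums) simp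
    hence "\<eta> sums (1 / 4)" by simp
    thus ?thesis using \<eta>_pos by (intro suminf_ennreal_eq) auto
  qed
  have "(\<Sum>i. emeasure coin_space (E i)) \<le> (\<Sum>i. ennreal h * hausdorff_weight t (U i) + ennreal (\<eta> i))"
    by (intro suminf_le E_le summableI)
  also have "\<dots> = ennreal h * (\<Sum>i. hausdorff_weight t (U i)) + ennreal (1 / 4)"
    by (simp add: suminf_add[symmetric] ennreal_suminf_cmult \<eta>_sum)
  also have "\<dots> \<le> ennreal h * ennreal (1 / (4 * h)) + ennreal (1 / 4)"
    using Usum by (intro add_mono mult_left_mono) auto
  also have "\<dots> = ennreal (h * (1 / (4 * h)) + 1 / 4)"
    using h by (subst ennreal_plus, simp, simp, subst ennreal_mult) auto
  also have "h * (1 / (4 * h)) + 1 / 4 = 1 / 2" using h by simp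
  finally have E_sum: "(\<Sum>i. emeasure coin_space (E i)) \<le> ennreal (1 / 2)" .
  have H_sum: "(\<Sum>j. emeasure coin_space (H j)) \<le> ennreal (C * \<kappa> ^ n0 / (1 - \<kappa>))"
  proof -
    have "(\<Sum>j. emeasure coin_space (H j)) \<le> (\<Sum>j. ennreal (C * \<kappa> ^ (n0 + j)))"
      using C(2) by (intro suminf_le summableI) (simp add: H_def \<kappa>_def)
    also have "(\<lambda>j. C * \<kappa> ^ n0 * \<kappa> ^ j) sums (C * \<kappa> ^ n0 * (1 / (1 - \<kappa>)))"
      using \<kappa> by (intro sums_mult geometric_sums) auto
    hence "(\<Sum>j. ennreal (C * \<kappa> ^ (n0 + j))) = ennreal (C * \<kappa> ^ n0 / (1 - \<kappa>))"
      using C \<kappa> by (intro suminf_ennreal_eq) (auto simp: power_add mult.assoc)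
    finally show ?thesis .
  qed
  have cover: "{\<omega> \<in> space coin_space. digit_series \<beta> \<omega> \<in> A} \<subseteq> (\<Union>i. E i) \<union> (\<Union>j. H j)"
  proof
    fix \<omega> assume \<omega>: "\<omega> \<in> {\<omega> \<in> space coin_space. digit_series \<beta> \<omega> \<in> A}"
    then obtain i where i: "digit_series \<beta> \<omega> \<in> U i" using U(3) by blast
    hence "u i \<in> U i" unfolding u_def by (rule someI)
    hence dist: "\<bar>digit_series \<beta> \<omega> - u i\<bar> \<le> diameter (U i)"
      using diameter_bounded_bound[OF U(1) i] by (simp add: dist_real_def)
    show "\<omega> \<in> (\<Union>i. E i) \<union> (\<Union>j. H j)"
    proof (cases "restrict \<omega> {1..n i} \<in> heavy_words h (n i)")
      case True
      hence "\<omega> \<in> H (n i - n0)" using \<omega> n(1)[of i] by (simp add: H_def cylinder_def)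
      thus ?thesis by blast
    next
      case False
      hence "\<omega> \<in> E i" using \<omega> i dist by (auto simp: E_def light_event_def)
      thus ?thesis by blast
    qed
  qed
  have "1 = emeasure coin_space {\<omega> \<in> space coin_space. digit_series \<beta> \<omega> \<in> A}"
    using A by (simp add: bernoulli_convolution_eq_distr[OF \<beta>_gt_1] emeasure_distr vimage_def Int_def conj_commute)
  also have "\<dots> \<le> emeasure coin_space ((\<Union>i. E i) \<union> (\<Union>j. H j))"
    using cover E_sets H_sets by (intro emeasure_mono) auto
  also have "\<dots> \<le> emeasure coin_space (\<Union>i. E i) + emeasure coin_space (\<Union>j. H j)"
    using E_sets H_sets by (intro emeasure_subadditive) auto
  also have "\<dots> \<le> ennreal (1 / 2) + ennreal (C * \<kappa> ^ n0 / (1 - \<kappa>))"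
    using emeasure_subadditive_countably[OF E_sets] emeasure_subadditive_countably[OF H_sets] E_sum H_sum
    by (intro add_mono) (auto intro: order_trans)
  also have "\<dots> = ennreal (1 / 2 + C * \<kappa> ^ n0 / (1 - \<kappa>))"
    using C \<kappa> by (subst ennreal_plus) auto
  also have "\<dots> < ennreal 1" by (rule ennreal_lessI[OF zero_less_one]) (use n0 in linarith)
  finally show False by simp
qed

lemma measure_hausdorff_dim_ge:
  assumes s: "s > 0" "growth_rate \<beta> * \<beta> powr s < 4"
  shows "measure_hausdorff_dim (bernoulli_convolution \<beta>) \<ge> ennreal s"
  unfolding measure_hausdorff_dim_def
proof (rule INF_greatest)
  fix A assume "A \<in> {A \<in> sets (bernoulli_convolution \<beta>). emeasure (bernoulli_convolution \<beta>) A = 1}"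
  hence A: "A \<in> sets borel" "emeasure (bernoulli_convolution \<beta>) A = 1"
    by (auto simp: bernoulli_convolution_eq_distr[OF \<beta>_gt_1])
  show "ennreal s \<le> hausdorff_dim A" unfolding hausdorff_dim_def
  proof (rule Inf_greatest)
    fix y assume "y \<in> {ennreal t |t. t \<ge> 0 \<and> hausdorff_measure t A = 0}"
    then obtain t where t: "y = ennreal t" "t \<ge> 0" "hausdorff_measure t A = 0" by blast
    have "\<not> t \<le> s" using hausdorff_measure_full_set_nonzero[OF s t(2) _ A] t(3) by blast
    thus "ennreal s \<le> y" using t by (simp add: ennreal_leI)
  qed
qed

end

section \<open>The dimension is at most one, and the conclusion\<close>

text \<open>Intervals of lengths \<open>e, e/2, e/3, \<dots>\<close> laid end to end cover a half-line because the harmonic series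
  diverges, while the sum of the \<open>s\<close>-th powers of their lengths is a multiple of \<open>e\<^sup>s\<close> for \<open>s > 1\<close>.
  Even indices cover the positive half-line, odd ones its mirror image.\<close>
lemma hausdorff_dim_real_line_le: "hausdorff_dim (UNIV :: real set) \<le> 1"
proof -
  have null: "hausdorff_measure s (UNIV :: real set) = 0" if s: "s > 1" for s
  proof -
    have "hausdorff_content s \<delta> (UNIV :: real set) = 0" if \<delta>: "\<delta> > 0" for \<delta>
    proof -
      have summ: "summable (\<lambda>i. real (Suc i) powr - s)"
        using s by (subst summable_Suc_iff) (simp add: summable_real_powr_iff)
      define Z where "Z = (\<Sum>i. real (Suc i) powr - s)"
      have Z: "Z \<ge> 0" unfolding Z_def by (intro suminf_nonneg summ) auto
      have bd: "hausdorff_content s \<delta> (UNIV :: real set) \<le> ennreal (2 * (e powr s * Z))" if e: "0 < e" "e \<le> \<delta>" for e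
      proof -
        define H where "H = (\<lambda>n. e * (harm n :: real))"
        define J where "J = (\<lambda>i. {H i..H (Suc i)})"
        define U where "U = (\<lambda>i. if even i then J (i div 2) else uminus ` J (i div 2))"
        have H_Suc: "H (Suc i) = H i + e / real (Suc i)" for i
          by (simp add: H_def harm_Suc algebra_simps divide_inverse)
        have H_le: "H i \<le> H (Suc i)" for i using e by (simp add: H_Suc)
        have diamJ: "diameter (J i) = e / real (Suc i)" for i
          using H_le[of i] by (simp add: J_def diameter_closed_interval H_Suc)
        have diamJ': "diameter (uminus ` J i) = e / real (Suc i)" for i
          using H_le[of i] by (simp add: J_def diameter_closed_interval H_Suc image_uminus_atLeastAtMost)
        have diamU: "diameter (U i) = e / real (Suc (i div 2))" for i
          by (simp add: U_def diamJ diamJ' del: of_nat_Suc)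
        have bddU: "bounded (U i)" for i by (simp add: U_def J_def image_uminus_atLeastAtMost)
        have neU: "U i \<noteq> {}" for i using H_le by (auto simp: U_def J_def)
        have covJ: "\<exists>i. x \<in> J i" if x: "x \<ge> 0" for x
        proof -
          have "filterlim (\<lambda>n. e * (harm n :: real)) at_top sequentially"
            using e harm_at_top by (intro filterlim_tendsto_pos_mult_at_top[OF tendsto_const])
          hence "eventually (\<lambda>n. H n > x) sequentially" unfolding H_def by (simp add: filterlim_at_top_dense)
          then obtain k where k: "H k > x" by (auto simp: eventually_sequentially)
          define m where "m = (LEAST n. H n > x)"
          have m: "H m > x" unfolding m_def by (rule LeastI) fact
          have "H 0 = 0" by (simp add: H_def harm_def)
          hence "m \<noteq> 0" using m x by (cases "m = 0") auto
          then obtain i where i: "m = Suc i" by (cases m) auto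
          have "\<not> H i > x" using not_less_Least[of i "\<lambda>n. H n > x"] i by (simp add: m_def)
          thus ?thesis using m i by (intro exI[of _ i]) (auto simp: J_def)
        qed
        have cov: "(UNIV :: real set) \<subseteq> (\<Union>i. U i)"
        proof
          fix x :: real
          show "x \<in> (\<Union>i. U i)"
          proof (cases "x \<ge> 0")
            case True
            then obtain i where "x \<in> J i" using covJ by blast
            hence "x \<in> U (2 * i)" by (simp add: U_def)
            thus ?thesis by blast
          next
            case False
            then obtain i where "- x \<in> J i" using covJ[of "- x"] by auto
            hence "x \<in> U (2 * i + 1)" by (auto simp: U_def image_iff intro!: bexI[of _ "- x"])
            thus ?thesis by blast
          qed
        qed
        have "diameter (U i) \<le> \<delta>" for i
        proof -
          have "e / real (Suc (i div 2)) \<le> e / 1" using e by (intro divide_left_mono) auto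
          thus ?thesis using e diamU[of i] by linarith
        qed
        hence "hausdorff_content s \<delta> (UNIV :: real set) \<le> (\<Sum>i. hausdorff_weight s (U i))"
          unfolding hausdorff_content_def using bddU cov by (intro INF_lower) auto
        also have "\<dots> = (\<Sum>i. ennreal (e powr s * real (Suc (i div 2)) powr - s))"
          using s neU e by (intro suminf_cong) (simp add: hausdorff_weight_def diamU powr_divide powr_minus_divide del: of_nat_Suc)
        also have "\<dots> \<le> ennreal (2 * (e powr s * Z))"
        proof (rule suminf_le_const[OF summableI])
          fix n
          have "(\<Sum>i<n. e powr s * real (Suc (i div 2)) powr - s) \<le> (\<Sum>i<2 * n. e powr s * real (Suc (i div 2)) powr - s)"
            by (intro sum_mono2) auto
          also have "\<dots> = 2 * (e powr s * (\<Sum>i<n. real (Suc i) powr - s))"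
            by (induction n) (simp_all add: algebra_simps del: of_nat_Suc)
          also have "\<dots> \<le> 2 * (e powr s * Z)" unfolding Z_def
            by (intro mult_left_mono sum_le_suminf summ) auto
          finally show "(\<Sum>i<n. ennreal (e powr s * real (Suc (i div 2)) powr - s)) \<le> ennreal (2 * (e powr s * Z))"
            by (subst sum_ennreal) (auto intro: ennreal_leI)
        qed
        finally show ?thesis .
      qed
      have "((\<lambda>e. ennreal (2 * (e powr s * Z))) \<longlongrightarrow> ennreal (2 * (0 * Z))) (at_right 0)"
      proof (intro tendsto_ennrealI tendsto_mult tendsto_const)
        show "((\<lambda>e. e powr s) \<longlongrightarrow> 0) (at_right 0)"
        proof -
          have "\<forall>\<^sub>F e in at_right (0::real). 0 \<le> e"
            using eventually_at_right_less by (rule eventually_mono) simp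
          thus ?thesis using s by (auto intro!: tendsto_eq_intros)
        qed
      qed
      moreover have "\<forall>\<^sub>F e in at_right 0. hausdorff_content s \<delta> (UNIV :: real set) \<le> ennreal (2 * (e powr s * Z))"
        using bd \<delta> eventually_at_right_real[OF \<delta>] by (auto elim: eventually_mono)
      ultimately have "hausdorff_content s \<delta> (UNIV :: real set) \<le> ennreal (2 * (0 * Z))"
        by (intro tendsto_lowerbound) auto
      thus ?thesis by simp
    qed
    hence "hausdorff_measure s (UNIV :: real set) \<le> 0"
      unfolding hausdorff_measure_def by (intro SUP_least) auto
    thus ?thesis by simp
  qed
  have le: "hausdorff_dim (UNIV :: real set) \<le> ennreal s" if "s > 1" for s
    unfolding hausdorff_dim_def using null[OF that] that by (intro Inf_lower) auto
  show ?thesis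
  proof (rule ennreal_le_epsilon)
    fix e :: real assume "e > 0"
    hence "hausdorff_dim (UNIV :: real set) \<le> ennreal (1 + e)" using le[of "1 + e"] by simp
    thus "hausdorff_dim (UNIV :: real set) \<le> 1 + ennreal e" using \<open>e > 0\<close> by simp
  qed
qed

lemma measure_hausdorff_dim_le_1:
  assumes "\<beta> > 1"
  shows "measure_hausdorff_dim (bernoulli_convolution \<beta>) \<le> 1"
proof -
  have "emeasure (bernoulli_convolution \<beta>) UNIV = 1"
    using prob_space.emeasure_space_1[OF prob_space_coin_space] assms
    by (simp add: bernoulli_convolution_eq_distr emeasure_distr)
  hence "measure_hausdorff_dim (bernoulli_convolution \<beta>) \<le> hausdorff_dim (UNIV :: real set)"
    unfolding measure_hausdorff_dim_def using assms
    by (intro INF_lower) (auto simp: bernoulli_convolution_eq_distr)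
  thus ?thesis using hausdorff_dim_real_line_le by (rule order_trans)
qed

theorem theorem2p1:
  fixes \<beta> :: "nat \<Rightarrow> real"
  assumes "\<And>n. pisot (\<beta> n)"
    and "\<And>n. \<beta> n \<in> {1<..<2}"
    and "(\<lambda>n. wasserstein1 (spectrum_prob (\<beta> n)) (lebesgue_prob (\<beta> n))) \<longlonglongrightarrow> 0"
  shows "(\<lambda>n. measure_hausdorff_dim (bernoulli_convolution (\<beta> n))) \<longlonglongrightarrow> 1"
proof -
  have \<beta>: "1 < \<beta> n" "\<beta> n < 2" for n using assms(2)[of n] by auto
  have base: "pisot_base (\<beta> n)" for n using assms(1) \<beta> by (simp add: pisot_base_def)
  have lower: "\<forall>\<^sub>F n in sequentially. ennreal s \<le> measure_hausdorff_dim (bernoulli_convolution (\<beta> n))"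
    if s: "0 < s" "s < 1" for s
  proof -
    \<comment> \<open>The gap gives \<open>\<beta> n powr (s - 1) \<le> c < 1\<close> uniformly in \<open>n\<close>, and \<open>\<delta>\<close> is chosen with \<open>4 * c + 16 * \<delta> < 4\<close>.\<close>
    define c where "c = (11 / 10 :: real) powr (s - 1)"
    have c: "0 < c" "c < 1" using s by (simp_all add: c_def powr_less_one)
    define \<delta> where "\<delta> = (1 - c) / 8"
    have \<delta>: "\<delta> > 0" using c by (simp add: \<delta>_def)
    have "\<forall>\<^sub>F n in sequentially. wasserstein1 (spectrum_prob (\<beta> n)) (lebesgue_prob (\<beta> n)) < ennreal (\<delta>\<^sup>2)"
      using \<delta> by (intro order_tendstoD(2)[OF assms(3)]) simp
    thus ?thesis
    proof (rule eventually_mono)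
      fix n assume W: "wasserstein1 (spectrum_prob (\<beta> n)) (lebesgue_prob (\<beta> n)) < ennreal (\<delta>\<^sup>2)"
      interpret pisot_base "\<beta> n" by (rule base)
      have "\<beta> n powr s \<le> \<beta> n powr 1" using s \<beta>_gt_1 by (intro powr_mono) auto
      hence p2: "\<beta> n powr s \<le> 2" using \<beta>_less_2 \<beta>_gt_1 by simp
      have "\<beta> n powr (s - 1) \<le> (11 / 10) powr (s - 1)"
        using s pisot_gap[OF pisot] by (intro powr_mono2') auto
      moreover have "\<beta> n powr s / \<beta> n = \<beta> n powr (s - 1)" using \<beta>_gt_1 by (simp add: powr_diff)
      ultimately have pc: "\<beta> n powr s / \<beta> n \<le> c" by (simp add: c_def)
      have "growth_rate (\<beta> n) * \<beta> n powr s \<le> (4 / \<beta> n + 8 * \<delta>) * \<beta> n powr s"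
        by (intro mult_right_mono growth_rate_le_of_wasserstein[OF \<delta> W]) auto
      also have "\<dots> = 4 * (\<beta> n powr s / \<beta> n) + 8 * \<delta> * \<beta> n powr s" by (simp add: algebra_simps)
      also have "\<dots> \<le> 4 * c + 8 * \<delta> * 2" using pc p2 \<delta> by (intro add_mono mult_left_mono) auto
      also have "\<dots> < 4" using c unfolding \<delta>_def by (simp add: field_simps)
      finally show "ennreal s \<le> measure_hausdorff_dim (bernoulli_convolution (\<beta> n))"
        by (rule measure_hausdorff_dim_ge[OF s(1)])
    qed
  qed
  show ?thesis
  proof (rule order_tendstoI)
    fix a :: ennreal assume a: "a < 1"
    then obtain r where r: "r \<ge> 0" "a = ennreal r" by (cases a) auto
    hence "r < 1" using a by simp
    define s where "s = (r + 1) / 2"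
    have s: "0 < s" "s < 1" "r < s" using r \<open>r < 1\<close> by (auto simp: s_def)
    have "a < ennreal s" using r s by (simp add: ennreal_lessI)
    thus "\<forall>\<^sub>F n in sequentially. a < measure_hausdorff_dim (bernoulli_convolution (\<beta> n))"
      using lower[OF s(1,2)] by (auto elim: eventually_mono intro: less_le_trans)
  next
    fix a :: ennreal assume a: "1 < a"
    show "\<forall>\<^sub>F n in sequentially. measure_hausdorff_dim (bernoulli_convolution (\<beta> n)) < a"
      using measure_hausdorff_dim_le_1[OF \<beta>(1)] a by (intro always_eventually allI) (rule le_less_trans)
  qed
qed

end
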